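(* Let $1<p<\infty$ and let $f\in L^p(T)$. Then $S_N^Tf\to f$ in $L^p(T)$ as $N\to\infty$.
   Context: $T\subset\mathbb{R}^2$ is the (closed) 45-90-45 triangle with vertices $(0,0)$, $(1,0)$, $(0,1)$; functions on $T$ are real-valued and $L^p(T)$ is taken with respect to Lebesgue measure. For positive integers $m,n$ define $$u_{m,n}(\xi,\eta):=\sin(\pi m\xi)\sin(\pi n\eta)-\sin(\pi m(1-\eta))\sin(\pi n(1-\xi)),\qquad (\xi,\eta)\in T.$$ (For $0<m<n$ these are eigenfunctions of the Dirichlet Laplacian on $T$.) For $0<m<n$ the Fourier coefficients of $f$ are $$f^{\triangle}(m,n):=\frac{1}{\|u_{m,n}\|_{L^2(T)}^2}\int_T f\,u_{m,n},$$ and the partial sums are $$S_N^Tf:=\sum_{0<m<n\leq N}f^{\triangle}(m,n)\,u_{m,n}.$$ *)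

theory Defs
  imports "HOL-Analysis.Analysis"
begin

definition right_triangle :: "(real \<times> real) set" where
  "right_triangle = convex hull {(0, 0), (1, 0), (0, 1)}"

text \<open>
  Elements of \<open>L\<^sup>p(A)\<close> are represented by functions on the whole plane, without passing to the
  quotient modulo almost everywhere equality; values outside \<open>A\<close> are irrelevant.
\<close>

definition Lp_space :: "real \<Rightarrow> (real \<times> real) set \<Rightarrow> (real \<times> real \<Rightarrow> real) set" where
  "Lp_space p A = {f. f \<in> borel_measurable (lebesgue_on A) \<and>
                      integrable (lebesgue_on A) (\<lambda>x. \<bar>f x\<bar> powr p)}"

definition Lp_norm :: "real \<Rightarrow> (real \<times> real) set \<Rightarrow> (real \<times> real \<Rightarrow> real) \<Rightarrow> real" where
  "Lp_norm p A f = (LINT x|lebesgue_on A. \<bar>f x\<bar> powr p) powr (1 / p)"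

text \<open>
  Membership in \<open>L\<^sup>p\<close> is part of the notion of convergence because \<open>Lp_norm\<close> takes the
  junk value \<open>0\<close> when the integral diverges.
\<close>

definition Lp_converges ::
    "real \<Rightarrow> (real \<times> real) set \<Rightarrow> (nat \<Rightarrow> real \<times> real \<Rightarrow> real) \<Rightarrow> (real \<times> real \<Rightarrow> real) \<Rightarrow> bool"
  where
  "Lp_converges p A g f \<longleftrightarrow>
     f \<in> Lp_space p A \<and> (\<forall>N. g N \<in> Lp_space p A) \<and>
     (\<lambda>N. Lp_norm p A (\<lambda>x. g N x - f x)) \<longlonglongrightarrow> 0"

definition u :: "nat \<Rightarrow> nat \<Rightarrow> real \<times> real \<Rightarrow> real" where
  "u m n = (\<lambda>(\<xi>, \<eta>). sin (pi * real m * \<xi>) * sin (pi * real n * \<eta>)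
                     - sin (pi * real m * (1 - \<eta>)) * sin (pi * real n * (1 - \<xi>)))"

definition fourier_coeff :: "(real \<times> real \<Rightarrow> real) \<Rightarrow> nat \<Rightarrow> nat \<Rightarrow> real" where
  "fourier_coeff f m n =
     1 / (Lp_norm 2 right_triangle (u m n))\<^sup>2 * (LINT x|lebesgue_on right_triangle. f x * u m n x)"

definition partial_sum :: "nat \<Rightarrow> (real \<times> real \<Rightarrow> real) \<Rightarrow> real \<times> real \<Rightarrow> real" where
  "partial_sum N f = (\<lambda>x. \<Sum>(m, n) \<in> {(m, n). 0 < m \<and> m < n \<and> n \<le> N}. fourier_coeff f m n * u m n x)"

end

theory Submission
  imports Defs "HOL-Complex_Analysis.Complex_Analysis"
begin

text \<open>
  Extended to the unit square by odd reflection \<open>(x, y) \<mapsto> (1 - y, 1 - x)\<close>, functions on the triangle have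
  double sine series whose square partial sums restrict to the partial sums in \<open>u\<close>. These are
  iterated one-dimensional partial sums, so they are uniformly bounded on \<open>L\<^sup>p\<close> by M. Riesz's theorem,
  and convergence follows from the density of the span of the \<open>u m n\<close>.

  Riesz's theorem is obtained for real parts of entire functions \<open>F\<close> on the unit circle. If \<open>Re F > 0\<close> and
  \<open>1 < p \<le> 2\<close>, take real parts in the mean value property of \<open>F powr p\<close> and use
  \<open>1 \<le> A * cos \<theta> powr p - B * cos (p * \<theta>)\<close> for \<open>\<bar>\<theta>\<bar> < pi / 2\<close>. The general case of these exponents
  follows by writing \<open>F\<close> as a difference of two such functions. Applying the bound for \<open>p\<close> to \<open>- \<i> * F\<^sup>2\<close>
  gives it for \<open>2 * p\<close> (Cotlar's trick), hence for all \<open>p > 1\<close>.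
\<close>

section \<open>The theorem of M. Riesz\<close>

text \<open>Only the independence of constants from \<open>N\<close> matters. Norms are therefore
  handled through integrals of p-th powers, and the inequalities of Minkowski and Hoelder are
  replaced by cruder versions with factors \<open>2 powr p\<close>.

  Stating Riesz's theorem for entire functions removes every question about boundary values, and
  truncation concerns polynomials anyway. The price is that \<bar>Re F\<bar> is not the real part of
  such a function, so the splitting into positive functions succeeds only up to a uniform
  approximation.

  The truncation bound compares finite sums with each other. It reaches all of L^p by density,
  together with a bound for each single partial sum that may depend on \<open>N\<close>.

  Density is where the boundary interferes: sines vanish on the sides of the square, and an odd
  reflection jumps across the hypotenuse unless the function vanishes there. Uniform approximation
  is thus proved only for odd functions with the factor sin (pi x) sin (pi y); dominated convergence
  does the rest.\<close>

lemma powr_add_le: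
  fixes a b p :: real
  assumes "0 \<le> a" "0 \<le> b" "0 < p"
  shows "(a + b) powr p \<le> 2 powr p * (a powr p + b powr p)"
proof -
  have "(a + b) powr p \<le> (2 * max a b) powr p"
    using assms by (intro powr_mono2) auto
  also have "\<dots> = 2 powr p * max a b powr p"
    using assms by (simp add: powr_mult)
  also have "\<dots> \<le> 2 powr p * (a powr p + b powr p)"
    by (intro mult_left_mono) (auto simp: max_def)
  finally show ?thesis .
qed

lemma norm_powr_add_le:
  fixes x y :: "'a::real_normed_vector"
  assumes "0 < p"
  shows "norm (x + y) powr p \<le> 2 powr p * (norm x powr p + norm y powr p)"
proof -
  have "norm (x + y) powr p \<le> (norm x + norm y) powr p"
    using assms by (intro powr_mono2 norm_triangle_ineq) auto
  also have "\<dots> \<le> 2 powr p * (norm x powr p + norm y powr p)"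
    using assms by (intro powr_add_le) auto
  finally show ?thesis .
qed

section \<open>Integral means over the unit circle\<close>

text \<open>The p-th power of the L^p norm for arc length of total mass 1; the parameter interval
  matches \<open>circlepath\<close>. The codomain is left open so that \<open>F\<close> and
  \<open>Re F\<close> are measured in the same way.\<close>

definition circle_int :: "real \<Rightarrow> (complex \<Rightarrow> 'a::real_normed_vector) \<Rightarrow> real" where
  "circle_int p F = integral {0..1} (\<lambda>t. norm (F (cis (2 * pi * t))) powr p)"

lemma continuous_on_circle:
  assumes "continuous_on (sphere 0 1) F"
  shows "continuous_on A (\<lambda>t. F (cis (2 * pi * t)))"
  by (rule continuous_on_compose2[OF assms]) (auto intro!: continuous_intros)

lemma continuous_on_norm_powr:
  fixes f :: "'b::topological_space \<Rightarrow> 'a::real_normed_vector"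
  assumes "continuous_on A f" "0 < p"
  shows "continuous_on A (\<lambda>t. norm (f t) powr p)"
  using assms by (intro continuous_on_powr' continuous_intros) auto

lemma circle_integrable:
  assumes "continuous_on (sphere 0 1) F" "0 < p"
  shows "(\<lambda>t. norm (F (cis (2 * pi * t))) powr p) integrable_on {0..1}"
  by (intro integrable_continuous_interval continuous_on_norm_powr continuous_on_circle assms)

lemma circle_int_nonneg:
  assumes "continuous_on (sphere 0 1) F" "0 < p"
  shows "0 \<le> circle_int p F"
  unfolding circle_int_def by (intro integral_nonneg circle_integrable assms) auto

lemma circle_int_le:
  assumes "continuous_on (sphere 0 1) F" "continuous_on (sphere 0 1) G" "0 < p"
    and "\<And>z. norm z = 1 \<Longrightarrow> norm (F z) \<le> norm (G z)"
  shows "circle_int p F \<le> circle_int p G"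
  unfolding circle_int_def using assms
  by (intro integral_le circle_integrable powr_mono2) auto

lemma circle_int_cong:
  assumes "\<And>z. norm z = 1 \<Longrightarrow> norm (F z) = norm (G z)"
  shows "circle_int p F = circle_int p G"
  unfolding circle_int_def using assms by (intro integral_cong) auto

lemma circle_int_add:
  assumes "continuous_on (sphere 0 1) F" "continuous_on (sphere 0 1) G" "0 < p"
  shows "circle_int p (\<lambda>z. F z + G z) \<le> 2 powr p * (circle_int p F + circle_int p G)"
proof -
  have "circle_int p (\<lambda>z. F z + G z) \<le> integral {0..1} (\<lambda>t. 2 powr p *
     (norm (F (cis (2 * pi * t))) powr p + norm (G (cis (2 * pi * t))) powr p))"
    unfolding circle_int_def using assms
    by (intro integral_le norm_powr_add_le integrable_on_mult_right integrable_add circle_integrable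
          continuous_intros) auto
  also have "\<dots> = 2 powr p * (circle_int p F + circle_int p G)"
    unfolding circle_int_def using assms by (simp add: integral_add circle_integrable)
  finally show ?thesis .
qed

text \<open>Cauchy's formula at the centre. Continuity on the closed disc with holomorphy inside is
  the form that \<open>positive_conj_bound\<close> establishes for the power of
  \<open>F\<close>.\<close>

lemma circle_mean_value:
  assumes "continuous_on (cball 0 1) F" "F holomorphic_on ball 0 1"
  shows "((\<lambda>t. F (cis (2 * pi * t))) has_integral F 0) {0..1}"
proof -
  have "((\<lambda>u. F u / (u - 0)) has_contour_integral (2 * of_real pi * \<i> * F 0)) (circlepath 0 1)"
    by (rule Cauchy_integral_circlepath[OF assms]) auto
  hence "((\<lambda>x. F (circlepath 0 1 x) / circlepath 0 1 x * vector_derivative (circlepath 0 1) (at x))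
      has_integral (2 * of_real pi * \<i> * F 0)) {0..1}"
    by (simp add: has_contour_integral)
  hence "((\<lambda>x. 2 * of_real pi * \<i> * F (cis (2 * pi * x))) has_integral (2 * of_real pi * \<i> * F 0)) {0..1}"
    by (rule has_integral_eq[rotated])
       (subst vector_derivative_circlepath, simp add: circlepath cis_conv_exp mult_ac)
  hence "((\<lambda>x. (1 / (2 * of_real pi * \<i>)) * (2 * of_real pi * \<i> * F (cis (2 * pi * x)))) has_integral
     (1 / (2 * of_real pi * \<i>)) * (2 * of_real pi * \<i> * F 0)) {0..1}"
    by (rule has_integral_mult_right)
  thus ?thesis by (simp add: field_simps)
qed

section \<open>The conjugate function bound for positive real parts\<close>

text \<open>As \<open>\<bar>\<theta>\<bar>\<close> approaches pi / 2 the power of the cosine tends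
  to 0, but \<open>p * \<bar>\<theta>\<bar>\<close> is then past pi / 2 and at most pi, so that
  \<open>cos (p * \<theta>)\<close> stays below a negative number. This is where the range 1 < p
  \<le> 2 enters.\<close>

lemma trig_inequality:
  fixes p :: real
  assumes "1 < p" "p \<le> 2"
  obtains A B where "0 \<le> A" "0 \<le> B"
    "\<And>\<theta>. \<bar>\<theta>\<bar> < pi / 2 \<Longrightarrow> 1 \<le> A * cos \<theta> powr p - B * cos (p * \<theta>)"
proof -
  \<comment> \<open>The midpoint of pi / (2 * p), where \<open>cos (p * \<theta>)\<close> changes
    sign, and pi / 2.\<close>
  define \<theta>0 where "\<theta>0 = (pi / p + pi) / 4"
  have p\<theta>0: "p * \<theta>0 = (pi + p * pi) / 4" using assms by (simp add: \<theta>0_def field_simps)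
  have \<theta>0: "0 < \<theta>0" "\<theta>0 < pi / 2" "pi / 2 < p * \<theta>0" "p * \<theta>0 < pi"
  proof -
    show "0 < \<theta>0" using assms by (simp add: \<theta>0_def add_pos_pos)
    have "pi / p < pi" using assms by (simp add: field_simps)
    moreover have "(r + pi) / 4 < pi / 2" if "r < pi" for r using that by simp
    ultimately show "\<theta>0 < pi / 2" unfolding \<theta>0_def by blast
    have "pi < p * pi" "p * pi \<le> 2 * pi" using assms by (auto simp: field_simps)
    moreover have "pi / 2 < (pi + x) / 4 \<and> (pi + x) / 4 < pi" if "pi < x" "x \<le> 2 * pi" for x
      using that pi_gt_zero by simp
    ultimately show "pi / 2 < p * \<theta>0" "p * \<theta>0 < pi" unfolding p\<theta>0 by blast+
  qed
  define c where "c = - cos (p * \<theta>0)"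
  define d where "d = cos \<theta>0"
  have c: "0 < c"
    using cos_monotone_0_pi[of "pi / 2" "p * \<theta>0"] \<theta>0 by (simp add: c_def)
  have d: "0 < d" using \<theta>0 by (simp add: d_def cos_gt_zero)
  \<comment> \<open>Beyond \<open>\<theta>0\<close> the choice of \<open>B\<close> makes the second
    term at least 1; up to \<open>\<theta>0\<close> the first term must outweigh 1 and a loss of at
    most \<open>B\<close>, which fixes \<open>A\<close>.\<close>
  define B where "B = 1 / c"
  define A where "A = (1 + B) / d powr p"
  have AB: "0 \<le> A" "0 \<le> B" using c d by (auto simp: A_def B_def)
  have "1 \<le> A * cos \<theta> powr p - B * cos (p * \<theta>)" if "0 \<le> \<theta>" "\<theta> < pi / 2" for \<theta>
  proof (cases "\<theta> \<le> \<theta>0")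
    case True
    have "d \<le> cos \<theta>" unfolding d_def using True that \<theta>0 by (intro cos_monotone_0_pi_le) auto
    hence "d powr p \<le> cos \<theta> powr p" using d assms by (intro powr_mono2) auto
    hence "A * d powr p \<le> A * cos \<theta> powr p" using AB by (intro mult_left_mono) auto
    moreover have "A * d powr p = 1 + B" using d by (simp add: A_def)
    moreover have "B * cos (p * \<theta>) \<le> B * 1" using AB by (intro mult_left_mono) auto
    ultimately show ?thesis by linarith
  next
    case False
    have "p * \<theta> \<le> p * (pi / 2)" using that assms by (intro mult_left_mono) auto
    also have "\<dots> \<le> 2 * (pi / 2)" using assms by (intro mult_right_mono) auto
    finally have "p * \<theta> \<le> pi" by simp
    moreover have "p * \<theta>0 \<le> p * \<theta>" using False assms by (intro mult_left_mono) auto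
    ultimately have "cos (p * \<theta>) \<le> - c" unfolding c_def using \<theta>0
      by (simp, intro cos_monotone_0_pi_le) auto
    hence "B * cos (p * \<theta>) \<le> B * (- c)" using AB by (intro mult_left_mono) auto
    hence "B * cos (p * \<theta>) \<le> -1" using c by (simp add: B_def)
    moreover have "0 \<le> A * cos \<theta> powr p" using AB by simp
    ultimately show ?thesis by linarith
  qed
  note key = this
  have "1 \<le> A * cos \<theta> powr p - B * cos (p * \<theta>)" if "\<bar>\<theta>\<bar> < pi / 2" for \<theta>
  proof -
    have "1 \<le> A * cos \<bar>\<theta>\<bar> powr p - B * cos (p * \<bar>\<theta>\<bar>)" using that by (intro key) auto
    thus ?thesis by (cases "\<theta> \<ge> 0") (auto simp: abs_if)
  qed
  with AB that show ?thesis by blast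
qed

text \<open>In polar form \<open>Re (w powr of_real p)\<close> is
  \<open>norm w powr p * cos (p * \<theta>)\<close>, so this is the inequality for angles multiplied
  by \<open>norm w powr p\<close>.\<close>

lemma norm_powr_le_Re:
  fixes p :: real
  assumes "1 < p" "p \<le> 2"
  obtains A B where "0 \<le> A" "0 \<le> B"
    "\<And>w. 0 < Re w \<Longrightarrow> norm w powr p \<le> A * Re w powr p - B * Re (w powr of_real p)"
proof -
  obtain A B where AB: "0 \<le> A" "0 \<le> B"
    "\<And>\<theta>. \<bar>\<theta>\<bar> < pi / 2 \<Longrightarrow> 1 \<le> A * cos \<theta> powr p - B * cos (p * \<theta>)"
    using trig_inequality[OF assms] by blast
  have "norm w powr p \<le> A * Re w powr p - B * Re (w powr of_real p)" if w: "0 < Re w" for w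
  proof -
    have w0: "w \<noteq> 0" using w by auto
    define \<theta> where "\<theta> = Im (Ln w)"
    have \<theta>: "\<bar>\<theta>\<bar> < pi / 2" unfolding \<theta>_def using Re_Ln_pos_lt_imp[OF w] .
    have "Re w = Re (exp (Ln w))" using w0 by simp
    also have "\<dots> = norm w * cos \<theta>" using w0 by (simp only: Re_exp \<theta>_def) simp
    finally have 1: "Re w = norm w * cos \<theta>" .
    have 2: "Re (w powr of_real p) = norm w powr p * cos (p * \<theta>)"
      using w0 by (simp add: powr_def Re_exp \<theta>_def)
    have "0 \<le> cos \<theta>" using \<theta> by (intro cos_ge_zero) auto
    hence 3: "Re w powr p = norm w powr p * cos \<theta> powr p"
      unfolding 1 by (simp add: powr_mult)
    have "norm w powr p * 1 \<le> norm w powr p * (A * cos \<theta> powr p - B * cos (p * \<theta>))"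
      using AB(3)[OF \<theta>] by (intro mult_left_mono) auto
    thus ?thesis unfolding 2 3 by (simp add: algebra_simps)
  qed
  with AB that show ?thesis by blast
qed

text \<open>Minimum principle for \<open>Re F\<close>, obtained from the maximum modulus principle
  for \<open>exp (- F z)\<close>, whose modulus is \<open>exp (- Re (F z))\<close>. Compactness of
  the circle provides a positive lower bound.\<close>

lemma Re_pos_on_cball:
  assumes F: "F holomorphic_on UNIV" and pos: "\<And>z. norm z = 1 \<Longrightarrow> 0 < Re (F z)"
    and w: "w \<in> cball 0 1"
  shows "0 < Re (F w)"
proof -
  have contF: "continuous_on S F" for S
    using F holomorphic_on_imp_continuous_on continuous_on_subset by blast
  have "continuous_on (sphere (0::complex) 1) (\<lambda>z. Re (F z))"
    by (intro continuous_intros contF)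
  then obtain z0 where z0: "z0 \<in> sphere 0 1" "\<And>z. z \<in> sphere 0 1 \<Longrightarrow> Re (F z0) \<le> Re (F z)"
    using continuous_attains_inf[of "sphere (0::complex) 1" "\<lambda>z. Re (F z)"] by auto
  have "norm (exp (- F w)) \<le> exp (- Re (F z0))"
  proof (rule maximum_modulus_frontier[of "\<lambda>z. exp (- F z)" "cball 0 1"])
    show "(\<lambda>z. exp (- F z)) holomorphic_on interior (cball 0 1)"
      using F by (auto intro!: holomorphic_intros intro: holomorphic_on_subset)
    show "continuous_on (closure (cball 0 1)) (\<lambda>z. exp (- F z))"
      by (intro continuous_intros contF)
  qed (use z0 w in auto)
  hence "Re (F z0) \<le> Re (F w)" by simp
  with pos[of z0] z0 show ?thesis by auto
qed

text \<open>The constant is one for p-th powers. Without the normalisation at 0 an imaginary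
  constant, which has real part 0, would refute any bound.\<close>

definition conj_bound :: "real \<Rightarrow> real \<Rightarrow> bool" where
  "conj_bound p C \<longleftrightarrow> 0 \<le> C \<and> (\<forall>F. F holomorphic_on UNIV \<longrightarrow> Im (F 0) = 0 \<longrightarrow>
     circle_int p F \<le> C * circle_int p (\<lambda>z. Re (F z)))"

lemma entire_continuous_on: "F holomorphic_on UNIV \<Longrightarrow> continuous_on S F"
  using holomorphic_on_imp_continuous_on continuous_on_subset by blast

lemma positive_conj_bound:
  assumes p: "1 < p" "p \<le> 2"
  obtains C where "0 \<le> C" "\<And>F. F holomorphic_on UNIV \<Longrightarrow> Im (F 0) = 0 \<Longrightarrow>
     (\<And>z. norm z = 1 \<Longrightarrow> 0 < Re (F z)) \<Longrightarrow> circle_int p F \<le> C * circle_int p (\<lambda>z. Re (F z))"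
proof -
  obtain A B where AB: "0 \<le> A" "0 \<le> B"
    "\<And>w. 0 < Re w \<Longrightarrow> norm w powr p \<le> A * Re w powr p - B * Re (w powr of_real p)"
    using norm_powr_le_Re[OF p] by blast
  have "circle_int p F \<le> A * circle_int p (\<lambda>z. Re (F z))"
    if F: "F holomorphic_on UNIV" "Im (F 0) = 0" "\<And>z. norm z = 1 \<Longrightarrow> 0 < Re (F z)" for F
  proof -
    have pos: "0 < Re (F z)" if "norm z \<le> 1" for z
      using Re_pos_on_cball[OF F(1,3), of z] that by auto
    have nr: "F z \<notin> \<real>\<^sub>\<le>\<^sub>0" if "norm z \<le> 1" for z
      using pos[OF that] by (auto simp: complex_nonpos_Reals_iff)
    have hol: "(\<lambda>z. F z powr of_real p) holomorphic_on ball 0 1"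
      using nr F(1) by (auto intro!: holomorphic_intros intro: holomorphic_on_subset)
    have cont: "continuous_on (cball 0 1) (\<lambda>z. F z powr of_real p)"
      using pos p by (intro continuous_on_powr_complex continuous_intros entire_continuous_on[OF F(1)])
        (auto intro: less_imp_le)
    have "((\<lambda>t. F (cis (2 * pi * t)) powr of_real p) has_integral F 0 powr of_real p) {0..1}"
      by (rule circle_mean_value[OF cont hol])
    hence mv: "((\<lambda>t. Re (F (cis (2 * pi * t)) powr of_real p)) has_integral Re (F 0 powr of_real p)) {0..1}"
      by (rule has_integral_Re)
    have "F 0 = of_real (Re (F 0))" using F(2) by (simp add: complex_eq_iff)
    hence F0: "0 \<le> Re (F 0 powr of_real p)"
      using pos[of 0] by (metis Re_complex_of_real less_imp_le norm_zero of_real_Re powr_ge_zero powr_of_real zero_le_one)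
    have int: "(\<lambda>t. norm (Re (F (cis (2 * pi * t)))) powr p) integrable_on {0..1}"
      using p by (intro circle_integrable continuous_intros entire_continuous_on[OF F(1)]) auto
    have "circle_int p F \<le> integral {0..1} (\<lambda>t. A * norm (Re (F (cis (2 * pi * t)))) powr p
        - B * Re (F (cis (2 * pi * t)) powr of_real p))"
      unfolding circle_int_def
    proof (intro integral_le)
      show "(\<lambda>t. A * norm (Re (F (cis (2 * pi * t)))) powr p
        - B * Re (F (cis (2 * pi * t)) powr of_real p)) integrable_on {0..1}"
        using mv by (intro integrable_diff integrable_on_mult_right int) auto
    next
      fix t :: real
      have "0 < Re (F (cis (2 * pi * t)))" by (rule pos) auto
      with AB(3)[OF this]
      show "norm (F (cis (2 * pi * t))) powr p \<le> A * norm (Re (F (cis (2 * pi * t)))) powr p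
        - B * Re (F (cis (2 * pi * t)) powr of_real p)" by simp
    qed (use p in \<open>auto intro!: circle_integrable entire_continuous_on[OF F(1)]\<close>)
    also have "\<dots> = A * circle_int p (\<lambda>z. Re (F z)) - B * Re (F 0 powr of_real p)"
      using mv int unfolding circle_int_def
      by (subst integral_diff) (auto intro!: integrable_on_mult_right simp: integral_unique has_integral_integrable)
    also have "\<dots> \<le> A * circle_int p (\<lambda>z. Re (F z))" using AB(2) F0 by simp
    finally show ?thesis .
  qed
  with AB(1) that show ?thesis by blast
qed

section \<open>Real trigonometric polynomials and the removal of positivity\<close>

text \<open>Real trigonometric polynomials, each given with an analytic polynomial that continues it
  into the disc as a real part. Agreement is asked only on the circle, where \<open>cnj z\<close> is
  the inverse of \<open>z\<close>.\<close>

definition trig_re :: "(complex \<Rightarrow> real) \<Rightarrow> bool" where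
  "trig_re h \<longleftrightarrow> (\<exists>A. \<forall>z. norm z = 1 \<longrightarrow> h z = Re (poly A z))"

lemma trig_re_add: "trig_re f \<Longrightarrow> trig_re g \<Longrightarrow> trig_re (\<lambda>z. f z + g z)"
proof -
  assume "trig_re f" "trig_re g"
  then obtain A B where "\<forall>z. norm z = 1 \<longrightarrow> f z = Re (poly A z)" "\<forall>z. norm z = 1 \<longrightarrow> g z = Re (poly B z)"
    unfolding trig_re_def by blast
  hence "\<forall>z. norm z = 1 \<longrightarrow> f z + g z = Re (poly (A + B) z)" by simp
  thus ?thesis unfolding trig_re_def by blast
qed

lemma trig_re_poly: "trig_re (\<lambda>z. Re (poly A z))"
  unfolding trig_re_def by blast

lemma trig_re_cong: "trig_re f \<Longrightarrow> (\<And>z. norm z = 1 \<Longrightarrow> f z = g z) \<Longrightarrow> trig_re g"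
  unfolding trig_re_def by metis

text \<open>Multiplying by \<open>cnj z\<close> lowers degrees by one on the circle; a resulting term \<open>b * cnj z\<close>
  has the same real part as \<open>cnj b * z\<close>.\<close>
lemma trig_re_cnj_mult: "trig_re (\<lambda>z. Re (cnj (poly A z) * poly B z))"
proof (induction A arbitrary: B)
  case 0
  show ?case using trig_re_poly[of 0] by simp
next
  case (pCons a A)
  show ?case
  proof (cases B)
    case B: (pCons b B0)
    have zz: "cnj z * z = 1" if "norm z = 1" for z :: complex
      using that by (metis complex_norm_square mult.commute of_real_1 one_power2)
    have 1: "trig_re (\<lambda>z. Re (poly (smult (cnj a) B) z))" by (rule trig_re_poly)
    have 2: "trig_re (\<lambda>z. Re (cnj (poly A z) * poly B0 z))" by (rule pCons.IH)
    have 3: "trig_re (\<lambda>z. Re (poly (smult (cnj b) (pCons 0 A)) z))" by (rule trig_re_poly)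
    show ?thesis
    proof (rule trig_re_cong[OF trig_re_add[OF 1 trig_re_add[OF 2 3]]])
      fix z :: complex assume z: "norm z = 1"
      have "cnj (poly (pCons a A) z) * poly B z =
        cnj a * poly B z + cnj (poly A z) * poly B0 z * (cnj z * z) + cnj (cnj b * (z * poly A z))"
        unfolding B by (simp add: algebra_simps)
      also have "Re \<dots> = Re (poly (smult (cnj a) B) z) + (Re (cnj (poly A z) * poly B0 z) +
            Re (poly (smult (cnj b) (pCons 0 A)) z))"
        unfolding zz[OF z] by (simp only: plus_complex.sel cnj.sel mult_1_right poly_smult poly_pCons add_0)
      finally show "Re (poly (smult (cnj a) B) z) + (Re (cnj (poly A z) * poly B0 z) +
            Re (poly (smult (cnj b) (pCons 0 A)) z)) = Re (cnj (poly (pCons a A) z) * poly B z)" ..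
    qed
  qed
qed

lemma trig_re_scale: "trig_re f \<Longrightarrow> trig_re (\<lambda>z. c * f z)"
proof -
  assume "trig_re f"
  then obtain A where "\<forall>z. norm z = 1 \<longrightarrow> f z = Re (poly A z)" unfolding trig_re_def by blast
  hence "\<forall>z. norm z = 1 \<longrightarrow> c * f z = Re (poly (smult (of_real c) A) z)" by simp
  thus ?thesis unfolding trig_re_def by blast
qed

text \<open>The identity behind this is 2 Re a Re b = Re (a b) + Re (cnj a b).\<close>

lemma trig_re_mult:
  assumes "trig_re f" "trig_re g"
  shows "trig_re (\<lambda>z. f z * g z)"
proof -
  obtain A B where AB: "\<And>z. norm z = 1 \<Longrightarrow> f z = Re (poly A z)" "\<And>z. norm z = 1 \<Longrightarrow> g z = Re (poly B z)"
    using assms unfolding trig_re_def by blast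
  show ?thesis
    by (rule trig_re_cong[OF trig_re_scale[OF trig_re_add[OF trig_re_poly[of "A * B"]
          trig_re_cnj_mult[of A B]], where c = "1/2"]])
       (simp add: AB algebra_simps)
qed

lemma trig_re_approx:
  assumes f: "continuous_on (sphere 0 1) f" and e: "0 < e"
  obtains A where "Im (poly A 0) = 0" "\<And>z. norm z = 1 \<Longrightarrow> \<bar>f z - Re (poly A z)\<bar> < e"
proof -
  have "\<exists>g. trig_re g \<and> (\<forall>z\<in>sphere 0 1. \<bar>f z - g z\<bar> < e)"
  proof (rule Stone_Weierstrass_HOL[where P = trig_re])
    show "trig_re (\<lambda>z. c)" for c using trig_re_poly[of "[:of_real c:]"] by simp
    show "continuous_on (sphere 0 1) g" if g: "trig_re g" for g
    proof -
      obtain A where "\<And>z. norm z = 1 \<Longrightarrow> g z = Re (poly A z)"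
        using g unfolding trig_re_def by blast
      moreover have "continuous_on (sphere (0::complex) 1) (\<lambda>z. Re (poly A z))"
        by (intro continuous_intros)
      ultimately show ?thesis by (auto intro: continuous_on_eq)
    qed
    show "\<exists>f. trig_re f \<and> f x \<noteq> f y" if "x \<in> sphere 0 1 \<and> y \<in> sphere 0 1 \<and> x \<noteq> y" for x y
    proof (cases "Re x = Re y")
      case True
      with that have "Im x \<noteq> Im y" by (auto simp: complex_eq_iff)
      thus ?thesis using trig_re_poly[of "[:0, -\<i>:]"]
        by (intro exI[of _ "\<lambda>z. Re (poly [:0, -\<i>:] z)"]) auto
    next
      case False
      thus ?thesis using trig_re_poly[of "[:0, 1:]"]
        by (intro exI[of _ "\<lambda>z. Re (poly [:0, 1:] z)"]) auto
    qed
  qed (use f e trig_re_add trig_re_mult in auto)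
  then obtain A where A: "\<And>z. norm z = 1 \<Longrightarrow> \<bar>f z - Re (poly A z)\<bar> < e"
    unfolding trig_re_def by (metis mem_sphere_0)
  \<comment> \<open>Subtracting an imaginary constant leaves the real part alone and makes the value
    at 0 real.\<close>
  define A' where "A' = A - [:\<i> * of_real (Im (poly A 0)):]"
  have "Im (poly A' 0) = 0" "\<And>z. norm z = 1 \<Longrightarrow> \<bar>f z - Re (poly A' z)\<bar> < e"
    using A by (auto simp: A'_def)
  thus ?thesis using that by blast
qed

text \<open>On the circle \<open>Re F\<close> is the difference of \<bar>Re F\<bar> and \<bar>Re
  F\<bar> - Re F, both nonnegative but not real parts of entire functions. A polynomial whose real
  part is close to a slight shift of \<bar>Re F\<bar> replaces the first, and its difference with
  \<open>F\<close> the second; the error disappears as e tends to 0.\<close>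

lemma conj_bound_le2:
  assumes p: "1 < p" "p \<le> 2"
  shows "\<exists>C. conj_bound p C"
proof -
  obtain C where C: "0 \<le> C" "\<And>F. F holomorphic_on UNIV \<Longrightarrow> Im (F 0) = 0 \<Longrightarrow>
     (\<And>z. norm z = 1 \<Longrightarrow> 0 < Re (F z)) \<Longrightarrow> circle_int p F \<le> C * circle_int p (\<lambda>z. Re (F z))"
    using positive_conj_bound[OF p] by metis
  define K where "K = 2 powr p * C * (2 * (2 powr p * 2 powr p))"
  have p0: "0 < p" using p by simp
  have bound: "circle_int p F \<le> K * circle_int p (\<lambda>z. Re (F z))"
    if F: "F holomorphic_on UNIV" "Im (F 0) = 0" for F
  proof -
    let ?f = "\<lambda>z. Re (F z)"
    have contF: "continuous_on (sphere 0 1) F" by (rule entire_continuous_on[OF F(1)])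
    have contf: "continuous_on (sphere 0 1) ?f" by (intro continuous_intros contF)
    have step: "circle_int p F \<le> K * (circle_int p ?f + (3 * e) powr p)" if e: "0 < e" for e
    proof -
      \<comment> \<open>The shift by \<open>2 * e\<close> exceeds the error \<open>e\<close>, so the
        real parts of \<open>poly A z\<close> and of \<open>poly A z - F z\<close> are both positive
        on the circle. Both are at most \<open>2 * \<bar>Re (F z)\<bar> + 3 * e\<close>.\<close>
      obtain A where A: "Im (poly A 0) = 0" "\<And>z. norm z = 1 \<Longrightarrow> \<bar>(\<bar>?f z\<bar> + 2 * e) - Re (poly A z)\<bar> < e"
        by (rule trig_re_approx[of "\<lambda>z. \<bar>?f z\<bar> + 2 * e" e]) (use e contf in \<open>auto intro!: continuous_intros\<close>)
      define G where "G = (\<lambda>z. poly A z - F z)"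
      have hol: "poly A holomorphic_on UNIV" "G holomorphic_on UNIV"
        unfolding G_def by (intro holomorphic_intros F)+
      have cont: "continuous_on (sphere 0 1) (poly A)" "continuous_on (sphere 0 1) G"
        by (intro entire_continuous_on hol)+
      define D where "D = 2 powr p * (2 powr p * (circle_int p ?f + (3 * e) powr p))"
      have E: "circle_int p h \<le> D" if "continuous_on (sphere 0 1) h"
        "\<And>z. norm z = 1 \<Longrightarrow> \<bar>h z\<bar> \<le> 2 * \<bar>?f z\<bar> + 3 * e" for h :: "complex \<Rightarrow> real"
      proof -
        have "circle_int p h \<le> circle_int p (\<lambda>z. 2 * \<bar>?f z\<bar> + 3 * e)"
          using that e contf p0 by (intro circle_int_le) (auto intro!: continuous_intros)
        also have "\<dots> \<le> 2 powr p * (circle_int p (\<lambda>z. 2 * \<bar>?f z\<bar>) + circle_int p (\<lambda>z. 3 * e))"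
          using contf p0 by (intro circle_int_add) (auto intro!: continuous_intros)
        also have "circle_int p (\<lambda>z. 2 * \<bar>?f z\<bar>) = 2 powr p * circle_int p ?f"
          unfolding circle_int_def by (simp add: powr_mult)
        also have "circle_int p (\<lambda>z. 3 * e) = (3 * e) powr p"
          unfolding circle_int_def using e by simp
        also have "2 powr p * (2 powr p * circle_int p ?f + (3 * e) powr p) \<le> D"
        proof -
          have "1 \<le> 2 powr p" using p by (simp add: ge_one_powr_ge_zero)
          hence "1 * (3 * e) powr p \<le> 2 powr p * (3 * e) powr p" by (intro mult_right_mono) auto
          thus ?thesis unfolding D_def by (intro mult_left_mono) (auto simp: algebra_simps)
        qed
        finally show ?thesis .
      qed
      have A': "circle_int p (poly A) \<le> C * D"
      proof -
        have "circle_int p (poly A) \<le> C * circle_int p (\<lambda>z. Re (poly A z))"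
          by (rule C(2)[OF hol(1) A(1)]) (use A(2) e in fastforce)
        also have "\<dots> \<le> C * D"
          using A(2) e C(1) by (intro mult_left_mono E continuous_intros cont) fastforce+
        finally show ?thesis .
      qed
      have G': "circle_int p G \<le> C * D"
      proof -
        have "circle_int p G \<le> C * circle_int p (\<lambda>z. Re (G z))"
        proof (rule C(2)[OF hol(2)])
          show "Im (G 0) = 0" using A(1) F(2) by (simp add: G_def)
          show "0 < Re (G z)" if "norm z = 1" for z
            using A(2)[OF that] e by (simp add: G_def)
        qed
        also have "\<dots> \<le> C * D"
        proof (intro mult_left_mono E continuous_intros cont C(1))
          show "\<bar>Re (G z)\<bar> \<le> 2 * \<bar>Re (F z)\<bar> + 3 * e" if "norm z = 1" for z
            using A(2)[OF that] e by (simp add: G_def)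
        qed
        finally show ?thesis .
      qed
      have "circle_int p F = circle_int p (\<lambda>z. poly A z + (- G z))" by (simp add: G_def)
      also have "\<dots> \<le> 2 powr p * (circle_int p (poly A) + circle_int p (\<lambda>z. - G z))"
        by (intro circle_int_add continuous_intros cont p0)
      also have "circle_int p (\<lambda>z. - G z) = circle_int p G" by (rule circle_int_cong) simp
      also have "2 powr p * (circle_int p (poly A) + circle_int p G) \<le> 2 powr p * (C * D + C * D)"
        using A' G' by (intro mult_left_mono add_mono) auto
      also have "\<dots> = K * (circle_int p ?f + (3 * e) powr p)"
        unfolding K_def D_def by (simp add: algebra_simps)
      finally show ?thesis .
    qed
    have "((\<lambda>e. (3 * e) powr p) \<longlongrightarrow> (3 * 0) powr p) (at_right 0)"
      using p0 by (intro tendsto_powr2 tendsto_intros eventually_at_rightI[of 0 1]) auto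
    hence "((\<lambda>e. K * (circle_int p ?f + (3 * e) powr p)) \<longlongrightarrow> K * (circle_int p ?f + (3 * 0) powr p)) (at_right 0)"
      by (intro tendsto_mult tendsto_add tendsto_const)
    moreover have "eventually (\<lambda>e. circle_int p F \<le> K * (circle_int p ?f + (3 * e) powr p)) (at_right 0)"
      using step by (auto intro!: eventually_at_rightI[of 0 1])
    ultimately have "circle_int p F \<le> K * (circle_int p ?f + (3 * 0) powr p)"
      by (rule tendsto_lowerbound) auto
    thus ?thesis by simp
  qed
  have "0 \<le> K" unfolding K_def using C(1) by auto
  with bound show ?thesis unfolding conj_bound_def by blast
qed

section \<open>Doubling the exponent\<close>

text \<open>For \<open>x > \<delta>\<close> write \<open>x = x powr (1 - p) * x powr p\<close> and
  use \<open>1 - p \<le> 0\<close>. Integrated over a space of mass at most 1, this compares a first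
  moment with a p-th one and stands in for Hoelder's inequality.\<close>

lemma le_add_powr:
  fixes x \<delta> p :: real
  assumes "1 \<le> p" "0 < \<delta>" "0 \<le> x"
  shows "x \<le> \<delta> + \<delta> powr (1 - p) * x powr p"
proof (cases "x \<le> \<delta>")
  case False
  hence "x powr (1 - p) \<le> \<delta> powr (1 - p)" using assms by (intro powr_mono2') auto
  hence "x powr (1 - p) * x powr p \<le> \<delta> powr (1 - p) * x powr p" by (intro mult_right_mono) auto
  moreover have "x powr (1 - p) * x powr p = x"
    using False assms by (simp flip: powr_add)
  ultimately show ?thesis using assms by linarith
qed (use assms in \<open>auto intro: add_increasing2\<close>)

text \<open>With \<open>\<delta> = m / 2\<close> half of \<open>m\<close> is absorbed on the
  left.\<close>

lemma powr_le_of_le_add: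
  fixes m J p :: real
  assumes p: "0 < p" and m: "0 \<le> m" and J: "0 \<le> J"
    and bound: "\<And>\<delta>. 0 < \<delta> \<Longrightarrow> m \<le> \<delta> + \<delta> powr (1 - p) * J"
  shows "m powr p \<le> 2 powr p * J"
proof (cases "m = 0")
  case False
  with m have "0 < m" by simp
  define d where "d = m / 2"
  have d: "0 < d" "m = d + d" using \<open>0 < m\<close> by (auto simp: d_def)
  from bound[OF d(1)] d have "d \<le> d powr (1 - p) * J" by linarith
  hence "d powr (p - 1) * d \<le> d powr (p - 1) * (d powr (1 - p) * J)" by (intro mult_left_mono) auto
  moreover have "d powr (p - 1) * d = d powr p" using d(1) by (simp add: powr_mult_base mult.commute)
  moreover have "d powr (p - 1) * (d powr (1 - p) * J) = J"
    using d(1) by (simp flip: mult.assoc powr_add)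
  ultimately have "d powr p \<le> J" by simp
  moreover have "m powr p = 2 powr p * d powr p" using d by (simp flip: powr_mult)
  ultimately show ?thesis by simp
qed (use J in simp)

lemma circle_mean_bound:
  fixes g :: "complex \<Rightarrow> real"
  assumes g: "continuous_on (sphere 0 1) g" and p: "1 \<le> p"
  shows "\<bar>integral {0..1} (\<lambda>t. g (cis (2 * pi * t)))\<bar> powr p \<le> 2 powr p * circle_int p g"
proof (rule powr_le_of_le_add)
  fix \<delta> :: real assume d: "0 < \<delta>"
  have int: "(\<lambda>t. norm (g (cis (2 * pi * t))) powr p) integrable_on {0..1}"
    using p by (intro circle_integrable g) auto
  have "norm (integral {0..1} (\<lambda>t. g (cis (2 * pi * t))))
    \<le> integral {0..1} (\<lambda>t. \<delta> + \<delta> powr (1 - p) * norm (g (cis (2 * pi * t))) powr p)"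
  proof (rule integral_norm_bound_integral)
    show "(\<lambda>t. \<delta> + \<delta> powr (1 - p) * norm (g (cis (2 * pi * t))) powr p) integrable_on {0..1}"
      using int by (intro integrable_add integrable_on_mult_right) auto
  qed (use d p in \<open>auto intro!: integrable_continuous_interval continuous_on_circle g le_add_powr\<close>)
  also have "\<dots> = \<delta> + \<delta> powr (1 - p) * circle_int p g"
    using int unfolding circle_int_def
    by (subst integral_add) (auto intro: integrable_on_mult_right)
  finally show "\<bar>integral {0..1} (\<lambda>t. g (cis (2 * pi * t)))\<bar> \<le> \<delta> + \<delta> powr (1 - p) * circle_int p g"
    by simp
qed (use p g circle_int_nonneg[of g p] in auto)

lemma Re_at_0_bound:
  assumes F: "F holomorphic_on UNIV" and p: "1 \<le> p"
  shows "\<bar>Re (F 0)\<bar> powr p \<le> 2 powr p * circle_int p (\<lambda>z. Re (F z))"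
proof -
  have "((\<lambda>t. F (cis (2 * pi * t))) has_integral F 0) {0..1}"
    using F by (intro circle_mean_value entire_continuous_on) (auto intro: holomorphic_on_subset)
  hence "integral {0..1} (\<lambda>t. Re (F (cis (2 * pi * t)))) = Re (F 0)"
    by (intro integral_unique has_integral_Re)
  moreover have "continuous_on (sphere 0 1) (\<lambda>z. Re (F z))"
    by (intro continuous_intros entire_continuous_on F)
  ultimately show ?thesis using circle_mean_bound[of "\<lambda>z. Re (F z)" p] p by simp
qed

text \<open>The real part of \<open>- \<i> * F z ^ 2\<close> is 2 Re F Im F, which contains the
  factor \<open>Re F\<close> that is to control everything. The bound for \<open>p\<close> thus
  estimates \<open>F z ^ 2\<close> by a product, which is split so that the part with
  \<open>F\<close> is small enough to be absorbed.\<close>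

lemma conj_bound_double:
  assumes p: "1 < p" and C: "conj_bound p C"
  shows "\<exists>C'. conj_bound (2 * p) C'"
proof -
  have C0: "0 \<le> C" using C by (simp add: conj_bound_def)
  define Q where "Q = 2 powr p * (C * 2 powr p)"
  \<comment> \<open>Any positive \<open>l\<close> with \<open>Q * l \<le> 1 / 2\<close> would serve:
    it weights the share of \<open>?X\<close> that is absorbed at the end.\<close>
  define l where "l = 1 / (2 * (Q + 1))"
  have Q: "0 \<le> Q" using C0 by (simp add: Q_def)
  have l: "0 < l" "Q * l \<le> 1 / 2" using Q by (auto simp: l_def field_simps)
  define K where "K = Q / (4 * l) + 2 powr p * 2 powr (2 * p)"
  have K: "0 \<le> K" using Q l by (simp add: K_def)
  have "circle_int (2 * p) F \<le> 2 * K * circle_int (2 * p) (\<lambda>z. Re (F z))"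
    if F: "F holomorphic_on UNIV" "Im (F 0) = 0" for F
  proof -
    let ?X = "circle_int (2 * p) F" and ?Y = "circle_int (2 * p) (\<lambda>z. Re (F z))"
    \<comment> \<open>Subtracting \<open>F 0 ^ 2\<close> yields \<open>G 0 = 0\<close>. Since
      \<open>F 0\<close> is real, this adds only an imaginary constant and does not affect
      \<open>Re (G z)\<close>.\<close>
    define G where "G = (\<lambda>z. - \<i> * (F z ^ 2 - F 0 ^ 2))"
    have G: "G holomorphic_on UNIV" unfolding G_def by (intro holomorphic_intros F)
    have G0: "Im (G 0) = 0" by (simp add: G_def)
    have ReG: "Re (G z) = 2 * (Re (F z) * Im (F z))" for z
      using F(2) by (simp add: G_def power2_eq_square)
    have contF: "continuous_on (sphere 0 1) F" by (rule entire_continuous_on[OF F(1)])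
    have contG: "continuous_on (sphere 0 1) G" by (rule entire_continuous_on[OF G])
    have sq: "norm (w ^ 2) powr p = norm w powr (2 * p)" for w :: complex
      by (simp add: norm_power powr_powr flip: powr_numeral)
    have i2: "(\<lambda>t. norm (F (cis (2 * pi * t))) powr (2 * p)) integrable_on {0..1}"
      "(\<lambda>t. norm (Re (F (cis (2 * pi * t)))) powr (2 * p)) integrable_on {0..1}"
      using p by (intro circle_integrable[of "\<lambda>z. Re (F z)"] circle_integrable contF continuous_intros; simp)+
    have "circle_int p (\<lambda>z. Re (G z)) \<le> integral {0..1} (\<lambda>t. 2 powr p *
       (l * norm (F (cis (2 * pi * t))) powr (2 * p) + norm (Re (F (cis (2 * pi * t)))) powr (2 * p) / (4 * l)))"
      unfolding circle_int_def
    proof (intro integral_le circle_integrable continuous_intros contG)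
      show "(\<lambda>t. 2 powr p * (l * norm (F (cis (2 * pi * t))) powr (2 * p)
         + norm (Re (F (cis (2 * pi * t)))) powr (2 * p) / (4 * l))) integrable_on {0..1}"
        using i2 by (intro integrable_on_mult_right integrable_add integrable_on_divide)
    next
      fix t :: real
      define w where "w = F (cis (2 * pi * t))"
      have "norm (Re (G (cis (2 * pi * t)))) powr p = 2 powr p * (\<bar>Re w\<bar> powr p * \<bar>Im w\<bar> powr p)"
        unfolding ReG w_def by (simp add: powr_mult abs_mult)
      also have "\<dots> \<le> 2 powr p * (\<bar>Re w\<bar> powr p * norm w powr p)"
        using p by (intro mult_left_mono powr_mono2 abs_Im_le_cmod) auto
      also have "\<dots> \<le> 2 powr p * (l * norm w powr (2 * p) + \<bar>Re w\<bar> powr (2 * p) / (4 * l))"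
      proof -
        define a where "a = norm w powr p"
        define b where "b = \<bar>Re w\<bar> powr p"
        have ab: "norm w powr (2 * p) = a * a" "\<bar>Re w\<bar> powr (2 * p) = b * b"
          unfolding a_def b_def by (simp_all flip: powr_add)
        \<comment> \<open>Weighted inequality between arithmetic and geometric mean.\<close>
        have "0 \<le> (2 * l * a - b) ^ 2 / (4 * l)" using l by simp
        hence "b * a \<le> l * (a * a) + b * b / (4 * l)"
          using l by (simp add: power2_eq_square field_simps)
        thus ?thesis unfolding ab a_def[symmetric] b_def[symmetric] by (intro mult_left_mono) auto
      qed
      finally show "norm (Re (G (cis (2 * pi * t)))) powr p \<le> 2 powr p * (l * norm (F (cis (2 * pi * t))) powr (2 * p)
         + norm (Re (F (cis (2 * pi * t)))) powr (2 * p) / (4 * l))" by (simp add: w_def)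
    qed (use p in auto)
    also have "\<dots> = 2 powr p * (l * ?X + ?Y / (4 * l))"
      using i2 unfolding circle_int_def
      by (subst integral_mult_right, subst integral_add) (auto intro: integrable_on_mult_right integrable_on_divide)
    finally have 1: "circle_int p (\<lambda>z. Re (G z)) \<le> 2 powr p * (l * ?X + ?Y / (4 * l))" .
    have 2: "circle_int p G \<le> C * circle_int p (\<lambda>z. Re (G z))"
      using C G G0 by (auto simp: conj_bound_def)
    \<comment> \<open>Pays for the constant \<open>F 0 ^ 2\<close> when \<open>F z ^ 2\<close> is
      recovered from \<open>G z\<close>.\<close>
    have 3: "\<bar>Re (F 0)\<bar> powr (2 * p) \<le> 2 powr (2 * p) * ?Y"
      using p by (intro Re_at_0_bound F(1)) auto
    have F0: "norm (F 0) = \<bar>Re (F 0)\<bar>" using F(2) by (simp add: cmod_def)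
    have "?X = circle_int p (\<lambda>z. F z ^ 2)" unfolding circle_int_def sq ..
    also have "\<dots> = circle_int p (\<lambda>z. \<i> * G z + F 0 ^ 2)" by (simp add: G_def)
    also have "\<dots> \<le> 2 powr p * (circle_int p (\<lambda>z. \<i> * G z) + circle_int p (\<lambda>z. F 0 ^ 2))"
      using p by (intro circle_int_add continuous_intros contG) auto
    also have "circle_int p (\<lambda>z. F 0 ^ 2) = \<bar>Re (F 0)\<bar> powr (2 * p)"
      unfolding circle_int_def sq F0 by simp
    also have "circle_int p (\<lambda>z. \<i> * G z) = circle_int p G"
      by (rule circle_int_cong) (simp add: norm_mult)
    also have "2 powr p * (circle_int p G + \<bar>Re (F 0)\<bar> powr (2 * p)) \<le>
       2 powr p * (C * (2 powr p * (l * ?X + ?Y / (4 * l))) + 2 powr (2 * p) * ?Y)"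
      using 1 2 3 C0 by (intro mult_left_mono add_mono order.trans[OF 2]) auto
    also have "\<dots> = Q * l * ?X + K * ?Y" unfolding Q_def K_def by (simp add: algebra_simps)
    \<comment> \<open>\<open>?X\<close> is the integral of a continuous function, hence finite, and
      half of it can be moved to the left.\<close>
    also have "Q * l * ?X \<le> 1 / 2 * ?X"
      using l p by (intro mult_right_mono circle_int_nonneg contF) auto
    finally show ?thesis by simp
  qed
  with K have "conj_bound (2 * p) (2 * K)" unfolding conj_bound_def by auto
  thus ?thesis ..
qed

text \<open>Halving an exponent above 2 keeps it above 1, so every \<open>p\<close> is reached by
  finitely many doublings from an exponent in the range 1 < p \<le> 2.\<close>

lemma conj_bound_exists:
  assumes p: "1 < p"
  shows "\<exists>C. conj_bound p C"
proof -
  have "\<exists>C. conj_bound p C" if "1 < p" "p \<le> 2 ^ (Suc n)" for n p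
    using that
  proof (induction n arbitrary: p)
    case 0
    thus ?case using conj_bound_le2 by simp
  next
    case (Suc n)
    show ?case
    proof (cases "p \<le> 2")
      case False
      have "1 < p / 2" "p / 2 \<le> 2 ^ Suc n" using False Suc.prems by auto
      then obtain C where C: "1 < p / 2" "conj_bound (p / 2) C" using Suc.IH by blast
      from conj_bound_double[OF C] show ?thesis by simp
    qed (use Suc conj_bound_le2 in auto)
  qed
  note bounded = this
  obtain n where "p < 2 ^ n" using real_arch_pow[of 2 p] by auto
  moreover have "(0::real) \<le> 2 ^ n" by simp
  ultimately have "p \<le> 2 ^ Suc n" unfolding power_Suc by linarith

  with bounded p show ?thesis by blast
qed

text \<open>Let \<open>B M\<close> be the analytic polynomial with imaginary part the sine polynomial. On the circle,
  \<open>cnj z ^ N * B M z = cnj (R z) + H z\<close>, where \<open>R\<close> is the reversed truncation, with \<open>\<bar>R z\<bar> = \<bar>B N z\<bar>\<close>, and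
  \<open>H\<close> comes from the remaining terms. The real and imaginary parts of this function are the real parts
  of \<open>R + H\<close> and \<open>- \<i> * (H - R)\<close>, so the conjugate function bound controls \<open>R\<close>.\<close>
lemma sine_truncation_bound_circle:
  assumes p: "1 < p"
  obtains C where "0 \<le> C" "\<And>M N (b :: nat \<Rightarrow> real). N \<le> M \<Longrightarrow>
     integral {0..1} (\<lambda>t. \<bar>\<Sum>m=1..N. b m * sin (2 * pi * real m * t)\<bar> powr p) \<le>
     C * integral {0..1} (\<lambda>t. \<bar>\<Sum>m=1..M. b m * sin (2 * pi * real m * t)\<bar> powr p)"
proof -
  obtain C where "conj_bound p C" using conj_bound_exists[OF p] by blast
  hence C0: "0 \<le> C" and C: "\<And>F. F holomorphic_on UNIV \<Longrightarrow> Im (F 0) = 0 \<Longrightarrow>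
     circle_int p F \<le> C * circle_int p (\<lambda>z. Re (F z))"
    by (auto simp: conj_bound_def)
  define K where "K = 2 powr p * (C + 2 powr p * (C + 2 powr p))"
  have K0: "0 \<le> K" using C0 by (simp add: K_def)
  have main: "integral {0..1} (\<lambda>t. \<bar>\<Sum>m=1..N. b m * sin (2 * pi * real m * t)\<bar> powr p) \<le>
     K * C * integral {0..1} (\<lambda>t. \<bar>\<Sum>m=1..M. b m * sin (2 * pi * real m * t)\<bar> powr p)"
    if NM: "N \<le> M" for M N and b :: "nat \<Rightarrow> real"
  proof -
    define B where "B = (\<lambda>L z. \<Sum>m=1..L. complex_of_real (b m) * z ^ m)"
    have holB: "B L holomorphic_on UNIV" for L unfolding B_def by (intro holomorphic_intros)
    have B0: "B L 0 = 0" for L unfolding B_def by (intro sum.neutral) auto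
    have ImB: "circle_int p (\<lambda>z. Im (B L z)) =
       integral {0..1} (\<lambda>t. \<bar>\<Sum>m=1..L. b m * sin (2 * pi * real m * t)\<bar> powr p)" for L
      unfolding circle_int_def B_def by (simp add: Complex.DeMoivre mult_ac)
    define R where "R = (\<lambda>z. \<Sum>m=1..N. complex_of_real (b m) * z ^ (N - m))"
    define H where "H = (\<lambda>z. \<Sum>m=Suc N..M. complex_of_real (b m) * z ^ (m - N))"
    define A where "A = (\<lambda>z. R z + H z)"
    \<comment> \<open>Adding \<open>A 0\<close> yields \<open>D 0 = 0\<close>. The coefficients are
      real, hence so is \<open>A 0\<close>, and \<open>Re (D z)\<close> is still the imaginary part
      of \<open>H z - R z\<close>.\<close>
    define D where "D = (\<lambda>z. - \<i> * (H z - R z + A 0))"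
    have hol: "R holomorphic_on UNIV" "A holomorphic_on UNIV" "D holomorphic_on UNIV"
      unfolding A_def D_def R_def H_def by (intro holomorphic_intros)+
    have cont: "continuous_on (sphere 0 1) (B L)" "continuous_on (sphere 0 1) R" "continuous_on (sphere 0 1) A"
       "continuous_on (sphere 0 1) D" for L
      by (intro entire_continuous_on hol holB)+
    have H0: "H 0 = 0" unfolding H_def by (intro sum.neutral) auto
    have "cnj (R 0) = R 0" unfolding R_def by (simp add: power_0_left if_distrib cong: if_cong)
    hence ImR0: "Im (R 0) = 0" by (simp add: complex_eq_iff)
    have ImA0: "Im (A 0) = 0" using H0 ImR0 by (simp add: A_def)
    have D0: "D 0 = 0" using H0 by (simp add: D_def A_def)
    have zz: "cnj z * z = 1" if "norm z = 1" for z :: complex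
      using that by (metis complex_norm_square mult.commute of_real_1 one_power2)
    have RN: "cnj z ^ N * B N z = cnj (R z)" if z: "norm z = 1" for z
    proof -
      have "cnj z ^ N * z ^ m = cnj z ^ (N - m)" if "m \<le> N" for m
      proof -
        have "cnj z ^ N * z ^ m = cnj z ^ (N - m) * (cnj z * z) ^ m"
          using that by (simp add: power_mult_distrib flip: power_add)
        thus ?thesis using zz[OF z] by simp
      qed
      thus ?thesis unfolding B_def R_def
        by (auto simp: sum_distrib_left mult.left_commute intro!: sum.cong)
    qed
    have HM: "cnj z ^ N * B M z = cnj (R z) + H z" if z: "norm z = 1" for z
    proof -
      have *: "cnj z ^ N * z ^ m = z ^ (m - N)" if "N \<le> m" for m
      proof -
        have "cnj z ^ N * z ^ m = (cnj z * z) ^ N * z ^ (m - N)"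
          using that by (simp add: power_mult_distrib mult.assoc flip: power_add)
        thus ?thesis using zz[OF z] by simp
      qed
      have "B M z = B N z + (\<Sum>m=Suc N..M. complex_of_real (b m) * z ^ m)"
        unfolding B_def using NM
        using sum.ub_add_nat[of 1 N "\<lambda>m. complex_of_real (b m) * z ^ m" "M - N"] by simp
      hence "cnj z ^ N * B M z = cnj (R z) + cnj z ^ N * (\<Sum>m=Suc N..M. complex_of_real (b m) * z ^ m)"
        using RN[OF z] by (simp add: distrib_left)
      also have "cnj z ^ N * (\<Sum>m=Suc N..M. complex_of_real (b m) * z ^ m) = H z"
        unfolding H_def by (auto simp: sum_distrib_left mult.left_commute * intro!: sum.cong)
      finally show ?thesis .
    qed
    have normHM: "norm (cnj (R z) + H z) = norm (B M z)" if "norm z = 1" for z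
      using HM[OF that] that by (metis complex_mod_cnj mult_1 norm_mult norm_power power_one)
    have ReA: "\<bar>Re (A z)\<bar> \<le> norm (B M z)" if "norm z = 1" for z
      using normHM[OF that] abs_Re_le_cmod[of "cnj (R z) + H z"] by (simp add: A_def)
    have ReD: "\<bar>Re (D z)\<bar> \<le> norm (B M z)" if "norm z = 1" for z
      using normHM[OF that] abs_Im_le_cmod[of "cnj (R z) + H z"] ImA0 by (simp add: D_def)
    have IA: "circle_int p (\<lambda>z. Re (A z)) \<le> circle_int p (B M)"
      using ReA p by (intro circle_int_le continuous_intros cont) auto
    have ID: "circle_int p (\<lambda>z. Re (D z)) \<le> circle_int p (B M)"
      using ReD p by (intro circle_int_le continuous_intros cont) auto
    have A: "circle_int p A \<le> C * circle_int p (B M)"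
      using C[OF hol(2) ImA0] mult_left_mono[OF IA C0] by simp
    have D: "circle_int p D \<le> C * circle_int p (B M)"
      using C[OF hol(3)] D0 mult_left_mono[OF ID C0] by simp
    have "norm (A 0) = \<bar>Re (A 0)\<bar>" using ImA0 by (simp add: cmod_def)
    hence "circle_int p (\<lambda>z. A 0) = \<bar>Re (A 0)\<bar> powr p" by (simp add: circle_int_def)
    also have "\<dots> \<le> 2 powr p * circle_int p (\<lambda>z. Re (A z))"
      using p by (intro Re_at_0_bound hol) auto
    also have "\<dots> \<le> 2 powr p * circle_int p (B M)" using IA by (intro mult_left_mono) auto
    finally have A0: "circle_int p (\<lambda>z. A 0) \<le> 2 powr p * circle_int p (B M)" .
    have "circle_int p (\<lambda>z. Im (B N z)) \<le> circle_int p (B N)"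
      using p by (intro circle_int_le continuous_intros cont) (auto simp: abs_Im_le_cmod)
    also have "\<dots> = circle_int p R"
    proof (rule circle_int_cong)
      fix z :: complex assume z: "norm z = 1"
      have "norm (R z) = norm (cnj z ^ N * B N z)" using RN[OF z] by simp
      thus "norm (B N z) = norm (R z)" using z by (simp add: norm_mult norm_power)
    qed
    also have "\<dots> \<le> circle_int p (\<lambda>z. 2 * R z)"
      using p by (intro circle_int_le continuous_intros cont) auto
    \<comment> \<open>The summands are \<open>R z + H z\<close> and
      \<open>R z - H z\<close>.\<close>
    also have "\<dots> = circle_int p (\<lambda>z. A z + (- \<i> * D z + A 0))"
      by (simp add: A_def D_def algebra_simps)
    also have "\<dots> \<le> 2 powr p * (circle_int p A + circle_int p (\<lambda>z. - \<i> * D z + A 0))"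
      using p by (intro circle_int_add continuous_intros cont) auto
    also have "\<dots> \<le> 2 powr p * (circle_int p A + 2 powr p * (circle_int p (\<lambda>z. - \<i> * D z) + circle_int p (\<lambda>z. A 0)))"
      using p by (intro mult_left_mono add_left_mono circle_int_add continuous_intros cont) auto
    also have "circle_int p (\<lambda>z. - \<i> * D z) = circle_int p D"
      by (rule circle_int_cong) (simp add: norm_mult)
    also have "2 powr p * (circle_int p A + 2 powr p * (circle_int p D + circle_int p (\<lambda>z. A 0))) \<le>
       2 powr p * (C * circle_int p (B M) + 2 powr p * (C * circle_int p (B M) + 2 powr p * circle_int p (B M)))"
      using A D A0 by (intro mult_left_mono add_mono) auto
    also have "\<dots> = K * circle_int p (B M)" unfolding K_def by (simp add: algebra_simps)
    \<comment> \<open>So far the bound is in terms of the whole of \<open>B M\<close>. A second use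
      of the conjugate function bound, for \<open>- \<i> * B M z\<close>, which is 0 at 0 and has
      real part \<open>Im (B M z)\<close>, returns to the sine polynomial.\<close>
    also have "circle_int p (B M) = circle_int p (\<lambda>z. - \<i> * B M z)"
      by (rule circle_int_cong) (simp add: norm_mult)
    also have "K * \<dots> \<le> K * (C * circle_int p (\<lambda>z. Re (- \<i> * B M z)))"
      using B0 holB K0 by (intro mult_left_mono C holomorphic_intros) auto
    also have "circle_int p (\<lambda>z. Re (- \<i> * B M z)) = circle_int p (\<lambda>z. Im (B M z))" by simp
    finally show ?thesis unfolding ImB by (simp add: mult_ac)
  qed
  show ?thesis
    using that[of "K * C"] main K0 C0 by auto
qed

section \<open>Sine polynomials on the square and the triangle\<close>

text \<open>On the circle the sines run through a full period of length 2, whereas the unit interval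
  is half of it. Symmetry about 1 makes the two halves contribute equally.\<close>

lemma integral_fold:
  fixes f :: "real \<Rightarrow> real"
  assumes f: "continuous_on UNIV f" and sym: "\<And>x. f (2 - x) = f x"
  shows "integral {0..1} (\<lambda>t. f (2 * t)) = integral {0..1} f"
proof -
  have int: "f integrable_on {a..b}" for a b
    by (intro integrable_continuous_interval continuous_on_subset[OF f]) auto
  have 1: "(f has_integral integral {0..1} f) (cbox 0 1)"
    using int[of 0 1] by (simp add: integrable_integral)
  have "((\<lambda>x. f (- 1 * x + 2)) has_integral (1 / \<bar>- 1\<bar> ^ DIM(real)) * integral {0..1} f)
      ((\<lambda>x. (1 / - 1) * x + - ((1 / - 1) * 2)) ` cbox 0 1)"
    using has_integral_affinity[OF 1, of "-1" 2] by simp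
  moreover have "(\<lambda>x. (1 / - 1) * x + - ((1 / - 1) * 2)) ` cbox 0 1 = {1..2::real}"
    by (auto simp: image_iff intro!: bexI[of _ "2 - x" for x])
  ultimately have "(f has_integral integral {0..1} f) {1..2}"
    using sym by (simp add: add.commute)
  hence "(f has_integral integral {0..1} f + integral {0..1} f) {0..2}"
    using 1 by (intro has_integral_combine[of 0 1 2]) auto
  hence 2: "(f has_integral integral {0..1} f + integral {0..1} f) (cbox 0 2)" by simp
  have "((\<lambda>x. f (2 * x + 0)) has_integral (1 / \<bar>2\<bar> ^ DIM(real)) * (integral {0..1} f + integral {0..1} f))
      ((\<lambda>x. (1 / 2) * x + - ((1 / 2) * 0)) ` cbox 0 2)"
    using has_integral_affinity[OF 2, of 2 0] by simp
  moreover have "(\<lambda>x. (1 / 2) * x + - ((1 / 2) * 0)) ` cbox 0 2 = {0..1::real}"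
    by (auto simp: image_iff intro!: bexI[of _ "2 * x" for x])
  ultimately show ?thesis by (simp add: integral_unique)
qed

lemma sine_truncation_bound:
  assumes p: "1 < p"
  obtains C where "0 \<le> C" "\<And>M N (b :: nat \<Rightarrow> real). N \<le> M \<Longrightarrow>
     integral {0..1} (\<lambda>t. \<bar>\<Sum>m=1..N. b m * sin (pi * real m * t)\<bar> powr p) \<le>
     C * integral {0..1} (\<lambda>t. \<bar>\<Sum>m=1..M. b m * sin (pi * real m * t)\<bar> powr p)"
proof -
  obtain C where C: "0 \<le> C" "\<And>M N (b :: nat \<Rightarrow> real). N \<le> M \<Longrightarrow>
     integral {0..1} (\<lambda>t. \<bar>\<Sum>m=1..N. b m * sin (2 * pi * real m * t)\<bar> powr p) \<le>
     C * integral {0..1} (\<lambda>t. \<bar>\<Sum>m=1..M. b m * sin (2 * pi * real m * t)\<bar> powr p)"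
    using sine_truncation_bound_circle[OF p] by blast
  have fold: "integral {0..1} (\<lambda>t. \<bar>\<Sum>m=1..L. b m * sin (2 * pi * real m * t)\<bar> powr p) =
     integral {0..1} (\<lambda>t. \<bar>\<Sum>m=1..L. b m * sin (pi * real m * t)\<bar> powr p)"
    for L and b :: "nat \<Rightarrow> real"
  proof -
    let ?f = "\<lambda>t. \<bar>\<Sum>m=1..L. b m * sin (pi * real m * t)\<bar> powr p"
    have "sin (pi * real m * (2 - x)) = - sin (pi * real m * x)" for m x
    proof -
      have "sin (pi * real m * (2 - x)) = sin (2 * (real m * pi) - pi * real m * x)"
        by (simp add: algebra_simps)
      also have "\<dots> = - sin (pi * real m * x)"
        unfolding sin_diff sin_double cos_double by (simp add: cos_npi sin_npi flip: power_mult)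
      finally show ?thesis .
    qed
    hence sym: "?f (2 - x) = ?f x" for x by (simp add: sum_negf)
    have "continuous_on UNIV (\<lambda>t. norm (\<Sum>m=1..L. b m * sin (pi * real m * t)) powr p)"
      using p by (intro continuous_on_norm_powr continuous_intros) auto
    hence cont: "continuous_on UNIV ?f" by simp
    show ?thesis using integral_fold[of ?f, OF cont sym] by (simp add: mult_ac)
  qed
  show ?thesis using that[OF C(1)] C(2) unfolding fold by blast
qed

section \<open>Square truncation in two variables\<close>

text \<open>The two degree bounds are separate so that one variable can be truncated at a
  time.\<close>

definition sine_poly :: "(nat \<Rightarrow> nat \<Rightarrow> real) \<Rightarrow> nat \<Rightarrow> nat \<Rightarrow> real \<times> real \<Rightarrow> real" where
  "sine_poly a M N = (\<lambda>(x, y). \<Sum>m=1..M. \<Sum>n=1..N. a m n * (sin (pi * real m * x) * sin (pi * real n * y)))"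

lemma continuous_on_sine_poly: "continuous_on A (sine_poly a M N)"
  unfolding sine_poly_def case_prod_unfold by (intro continuous_intros)

lemma sine_poly_transpose: "sine_poly a M N (y, x) = sine_poly (\<lambda>m n. a n m) N M (x, y)"
  unfolding sine_poly_def by (subst sum.swap) (simp add: mult_ac)

abbreviation unit_square :: "(real \<times> real) set" where
  "unit_square \<equiv> cbox (0, 0) (1, 1)"

lemma sine_poly_integral_transpose:
  assumes p: "0 < p"
  shows "integral unit_square (\<lambda>x. \<bar>sine_poly a M N x\<bar> powr p) =
    integral unit_square (\<lambda>x. \<bar>sine_poly (\<lambda>m n. a n m) N M x\<bar> powr p)"
proof -
  have "continuous_on unit_square (\<lambda>x. norm (sine_poly a M N x) powr p)"
    by (intro continuous_on_norm_powr continuous_on_sine_poly p)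
  hence "integral unit_square (\<lambda>(x, y). \<bar>sine_poly a M N (x, y)\<bar> powr p) =
    integral unit_square (\<lambda>(x, y). \<bar>sine_poly a M N (y, x)\<bar> powr p)"
    by (intro integral_swap_2dim) (simp add: case_prod_unfold)
  moreover have "(\<lambda>(x, y). \<bar>sine_poly a M N (y, x)\<bar> powr p) = (\<lambda>x. \<bar>sine_poly (\<lambda>m n. a n m) N M x\<bar> powr p)"
    by (simp add: fun_eq_iff sine_poly_transpose[of a M N])
  ultimately show ?thesis by (simp add: case_prod_unfold)
qed

text \<open>For fixed \<open>x\<close> the slice in \<open>y\<close> is a sine polynomial in one
  variable with coefficients depending on \<open>x\<close>. The constant does not see the
  coefficients, so the bound can be integrated in \<open>x\<close>. Transposition treats the other
  variable, whence \<open>C * C\<close>.\<close>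

lemma sine_poly_truncation_bound:
  assumes p: "1 < p"
  obtains C where "0 \<le> C" "\<And>M N a. N \<le> M \<Longrightarrow>
     integral unit_square (\<lambda>x. \<bar>sine_poly a N N x\<bar> powr p) \<le>
     C * integral unit_square (\<lambda>x. \<bar>sine_poly a M M x\<bar> powr p)"
proof -
  obtain C where C: "0 \<le> C" "\<And>M N (b :: nat \<Rightarrow> real). N \<le> M \<Longrightarrow>
     integral {0..1} (\<lambda>t. \<bar>\<Sum>m=1..N. b m * sin (pi * real m * t)\<bar> powr p) \<le>
     C * integral {0..1} (\<lambda>t. \<bar>\<Sum>m=1..M. b m * sin (pi * real m * t)\<bar> powr p)"
    using sine_truncation_bound[OF p] by blast
  have one: "integral unit_square (\<lambda>x. \<bar>sine_poly a L N x\<bar> powr p) \<le>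
     C * integral unit_square (\<lambda>x. \<bar>sine_poly a L M x\<bar> powr p)" if NM: "N \<le> M" for L M N a
  proof -
    have cont: "continuous_on A (\<lambda>x. \<bar>sine_poly a L K x\<bar> powr p)" for A K
      using continuous_on_norm_powr[OF continuous_on_sine_poly[of A a L K], of p] p by simp
    have iter: "integral unit_square (\<lambda>x. \<bar>sine_poly a L K x\<bar> powr p) =
       integral {0..1} (\<lambda>x. integral {0..1} (\<lambda>y. \<bar>sine_poly a L K (x, y)\<bar> powr p))" for K
      using integral_prod_continuous[OF cont[of unit_square]] by simp
    have "continuous_on {0..1} (\<lambda>x. integral (cbox 0 1) (\<lambda>y. \<bar>sine_poly a L K (x, y)\<bar> powr p))" for K
      by (intro integral_continuous_on_param) (use cont[of "{0..1} \<times> cbox 0 1" K] in \<open>simp add: case_prod_unfold\<close>)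
    hence int: "(\<lambda>x. integral {0..1} (\<lambda>y. \<bar>sine_poly a L K (x, y)\<bar> powr p)) integrable_on {0..1}" for K
      by (intro integrable_continuous_interval) simp
    have slice: "sine_poly a L K (x, y) = (\<Sum>n=1..K. (\<Sum>m=1..L. a m n * sin (pi * real m * x)) * sin (pi * real n * y))"
      for K x y
      unfolding sine_poly_def by (subst sum.swap) (simp add: sum_distrib_left sum_distrib_right mult_ac)
    have "integral {0..1} (\<lambda>x. integral {0..1} (\<lambda>y. \<bar>sine_poly a L N (x, y)\<bar> powr p)) \<le>
      integral {0..1} (\<lambda>x. C * integral {0..1} (\<lambda>y. \<bar>sine_poly a L M (x, y)\<bar> powr p))"
      by (intro integral_le int integrable_on_mult_right) (unfold slice, rule C(2)[OF NM])
    thus ?thesis unfolding iter by simp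
  qed
  have "integral unit_square (\<lambda>x. \<bar>sine_poly a N N x\<bar> powr p) \<le>
     C * C * integral unit_square (\<lambda>x. \<bar>sine_poly a M M x\<bar> powr p)" if NM: "N \<le> M" for M N a
  proof -
    have p0: "0 < p" using p by simp
    have "integral unit_square (\<lambda>x. \<bar>sine_poly a N N x\<bar> powr p) \<le>
      C * integral unit_square (\<lambda>x. \<bar>sine_poly a N M x\<bar> powr p)" by (rule one[OF NM])
    also have "integral unit_square (\<lambda>x. \<bar>sine_poly a N M x\<bar> powr p) =
       integral unit_square (\<lambda>x. \<bar>sine_poly (\<lambda>m n. a n m) M N x\<bar> powr p)"
      by (rule sine_poly_integral_transpose[OF p0])
    also have "\<dots> \<le> C * integral unit_square (\<lambda>x. \<bar>sine_poly (\<lambda>m n. a n m) M M x\<bar> powr p)"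
      by (rule one[OF NM])
    also have "integral unit_square (\<lambda>x. \<bar>sine_poly (\<lambda>m n. a n m) M M x\<bar> powr p) =
       integral unit_square (\<lambda>x. \<bar>sine_poly a M M x\<bar> powr p)"
      by (rule sine_poly_integral_transpose[OF p0, symmetric])
    finally show ?thesis using C(1) by (simp add: mult.assoc mult_left_mono)
  qed
  thus ?thesis using that[of "C * C"] C(1) by simp
qed

section \<open>The triangle and its reflected copy\<close>

lemma right_triangle_eq: "right_triangle = {(x, y). 0 \<le> x \<and> 0 \<le> y \<and> x + y \<le> 1}"
proof -
  have "(\<exists>u\<ge>0. u + x + y = 1) \<longleftrightarrow> x + y \<le> 1" for x y :: real
    by (auto intro!: exI[of _ "1 - x - y"])
  thus ?thesis unfolding right_triangle_def convex_hull_3 by auto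
qed

lemma compact_right_triangle: "compact right_triangle"
  unfolding right_triangle_def by (intro finite_imp_compact_convex_hull) auto

lemma right_triangle_lmeasurable: "right_triangle \<in> lmeasurable"
  by (intro lmeasurable_compact compact_right_triangle)

lemma right_triangle_sets: "right_triangle \<in> sets lebesgue"
  using right_triangle_lmeasurable by (rule fmeasurableD)

abbreviation tri :: "(real \<times> real) measure" where
  "tri \<equiv> lebesgue_on right_triangle"

lemma finite_measure_tri: "finite_measure tri"
  by (intro finite_measure_lebesgue_on right_triangle_lmeasurable)

lemma tri_measurable: "continuous_on right_triangle f \<Longrightarrow> f \<in> borel_measurable tri"
  for f :: "real \<times> real \<Rightarrow> real"
  by (intro continuous_imp_measurable_on_sets_lebesgue right_triangle_sets)

lemma tri_integrable:
  fixes f :: "real \<times> real \<Rightarrow> real"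
  assumes f: "continuous_on right_triangle f"
  shows "integrable tri f"
proof -
  have "bounded (f ` right_triangle)"
    by (intro compact_imp_bounded compact_continuous_image f compact_right_triangle)
  then obtain B where B: "\<And>x. x \<in> right_triangle \<Longrightarrow> norm (f x) \<le> B"
    unfolding bounded_iff by blast
  interpret finite_measure tri by (rule finite_measure_tri)
  show ?thesis
    by (rule integrable_const_bound[of _ B])
       (use B in \<open>auto intro!: AE_I2 tri_measurable f\<close>)
qed

lemma tri_integral:
  fixes f :: "real \<times> real \<Rightarrow> real"
  assumes f: "continuous_on right_triangle f"
  shows "(LINT x|tri. f x) = integral right_triangle f" "f integrable_on right_triangle"
  using lebesgue_integral_eq_integral[OF tri_integrable[OF f] right_triangle_sets]
    integrable_on_lebesgue_on[OF tri_integrable[OF f] right_triangle_sets] by auto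

definition refl_diag :: "real \<times> real \<Rightarrow> real \<times> real" where
  "refl_diag = (\<lambda>(x, y). (1 - y, 1 - x))"

lemma refl_diag_idem: "refl_diag (refl_diag x) = x"
  by (auto simp: refl_diag_def split: prod.splits)

lemma refl_diag_cbox: "refl_diag ` cbox (a, b) (c, d) = cbox (1 - d, 1 - c) (1 - b, 1 - a)"
proof -
  have "refl_diag x \<in> cbox (1 - d, 1 - c) (1 - b, 1 - a)" if "x \<in> cbox (a, b) (c, d)" for x a b c d
    using that by (auto simp: refl_diag_def mem_box Basis_prod_def inner_Pair split: prod.splits)
  note * = this
  show ?thesis
  proof (intro equalityI subsetI)
    fix z assume "z \<in> cbox (1 - d, 1 - c) (1 - b, 1 - a)"
    hence "refl_diag z \<in> cbox (a, b) (c, d)" using *[of z "1 - d" "1 - c" "1 - b" "1 - a"] by simp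
    thus "z \<in> refl_diag ` cbox (a, b) (c, d)" by (metis image_eqI refl_diag_idem)
  qed (use * in blast)
qed

text \<open>Reflection in the line x + y = 1 preserves area and maps the triangle to the rest of the
  square, with only the hypotenuse in common. Although each \<open>u m n\<close> is odd, absolute
  powers of their sums and products of two of them are even, as required here.\<close>

lemma integral_square_triangle:
  fixes f :: "real \<times> real \<Rightarrow> real"
  assumes f: "f integrable_on right_triangle" and sym: "\<And>x. f (refl_diag x) = f x"
  shows "integral unit_square f = 2 * integral right_triangle f"
proof -
  let ?i = "integral right_triangle f"
  have sub: "right_triangle \<subseteq> unit_square"
    by (auto simp: right_triangle_eq mem_box Basis_prod_def inner_Pair)
  have T: "(f has_integral ?i) right_triangle" using f by (rule integrable_integral)
  hence 1: "((\<lambda>x. if x \<in> right_triangle then f x else 0) has_integral ?i) unit_square"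
    using sub by (simp add: has_integral_restrict)
  have "((\<lambda>x. if refl_diag x \<in> right_triangle then f (refl_diag x) else 0) has_integral (1 / 1) *\<^sub>R ?i)
     (refl_diag ` unit_square)"
  proof (rule has_integral_twiddle[OF _ _ _ _ _ _ _ 1])
    show "continuous (at x) refl_diag" for x
      unfolding refl_diag_def case_prod_unfold by (intro continuous_intros)
    show "\<exists>w z. refl_diag ` cbox u v = cbox w z" for u v
      using refl_diag_cbox by (metis surj_pair)
    show "\<exists>w z. refl_diag ` cbox u v = cbox w z" for u v
      using refl_diag_cbox by (metis surj_pair)
    show "measure lborel (refl_diag ` cbox u v) = 1 * measure lborel (cbox u v)" for u v
      by (cases u; cases v) (simp add: refl_diag_cbox content_Pair content_real_if)
  qed (auto simp: refl_diag_idem)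
  moreover have "refl_diag x \<in> right_triangle \<longleftrightarrow> x \<in> refl_diag ` right_triangle" for x
    by (metis image_iff refl_diag_idem)
  ultimately have "((\<lambda>x. if x \<in> refl_diag ` right_triangle then f x else 0) has_integral ?i) unit_square"
    by (simp add: refl_diag_cbox sym cong: if_cong)
  moreover have sub': "refl_diag ` right_triangle \<subseteq> unit_square"
    using sub image_mono[OF sub, of refl_diag] by (simp add: refl_diag_cbox)
  ultimately have T': "(f has_integral ?i) (refl_diag ` right_triangle)"
    by (simp add: has_integral_restrict)
  have "negligible {x :: real \<times> real. (1, 1) \<bullet> x = 1}"
    by (intro negligible_hyperplane) (simp add: zero_prod_def)
  moreover have "right_triangle \<inter> refl_diag ` right_triangle \<subseteq> {x. (1, 1) \<bullet> x = 1}"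
    by (auto simp: right_triangle_eq refl_diag_def inner_Pair)
  ultimately have "negligible (right_triangle \<inter> refl_diag ` right_triangle)"
    by (rule negligible_subset)
  with T T' have "(f has_integral (?i + ?i)) (right_triangle \<union> refl_diag ` right_triangle)"
    by (rule has_integral_Un)
  also have "right_triangle \<union> refl_diag ` right_triangle = unit_square"
  proof (intro equalityI subsetI)
    fix z assume z: "z \<in> unit_square"
    show "z \<in> right_triangle \<union> refl_diag ` right_triangle"
    proof (cases "fst z + snd z \<le> 1")
      case False
      hence "refl_diag z \<in> right_triangle"
        using z by (cases z) (auto simp: right_triangle_eq mem_box Basis_prod_def inner_Pair refl_diag_def)
      thus ?thesis by (metis UnI2 image_eqI refl_diag_idem)
    qed (use z in \<open>auto simp: right_triangle_eq mem_box Basis_prod_def inner_Pair\<close>)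
  qed (use sub sub' in auto)
  finally show ?thesis by (simp add: integral_unique)
qed

section \<open>Eigenfunctions as antisymmetric double sine series\<close>

lemma sin_orthogonal:
  assumes "0 < m" "0 < n"
  shows "integral {0..1} (\<lambda>x. sin (pi * real m * x) * sin (pi * real n * x)) = (if m = n then 1 / 2 else 0)"
proof -
  \<comment> \<open>Frequencies are integers because \<open>m - n\<close> may be negative.\<close>
  have cos_int: "((\<lambda>x. cos (pi * of_int k * x)) has_integral (if k = 0 then 1 else 0)) {0..1}" for k :: int
  proof (cases "k = 0")
    case True
    thus ?thesis using has_integral_const_real[of "1 :: real" 0 1] by simp
  next
    case False
    have "((\<lambda>x. cos (pi * of_int k * x)) has_integral
        sin (pi * of_int k * 1) / (pi * of_int k) - sin (pi * of_int k * 0) / (pi * of_int k)) {0..1}"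
      using False by (intro fundamental_theorem_of_calculus)
        (auto intro!: derivative_eq_intros simp flip: has_real_derivative_iff_has_vector_derivative)
    moreover have "sin (pi * of_int k) = 0" by (metis mult.commute sin_zero_iff_int2)
    ultimately show ?thesis using False by simp
  qed
  have "((\<lambda>x. 1 / 2 * (cos (pi * of_int (int m - int n) * x) - cos (pi * of_int (int m + int n) * x)))
     has_integral 1 / 2 * ((if int m - int n = 0 then 1 else 0) - (if int m + int n = 0 then 1 else 0))) {0..1}"
    by (intro has_integral_mult_right has_integral_diff cos_int)
  note hi = this
  have "sin (pi * real m * x) * sin (pi * real n * x) =
     1 / 2 * (cos (pi * of_int (int m - int n) * x) - cos (pi * of_int (int m + int n) * x))" for x
  proof -
    have "pi * of_int (int m - int n) * x = pi * real m * x - pi * real n * x"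
      "pi * of_int (int m + int n) * x = pi * real m * x + pi * real n * x"
      by (simp_all add: algebra_simps)
    thus ?thesis unfolding sin_times_sin by simp
  qed
  hence "integral {0..1} (\<lambda>x. sin (pi * real m * x) * sin (pi * real n * x)) =
    1 / 2 * ((if int m - int n = 0 then 1 else 0) - (if int m + int n = 0 then 1 else 0))"
    using integral_unique[OF hi] by (simp only:)
  also have "\<dots> = (if m = n then 1 / 2 else 0)" using assms by auto
  finally show ?thesis .
qed

lemma sin_reflect: "sin (pi * real m * (1 - x)) = - ((-1) ^ m) * sin (pi * real m * x)"
proof -
  have "sin (pi * real m * (1 - x)) = sin (real m * pi - pi * real m * x)"
    by (simp add: algebra_simps)
  thus ?thesis unfolding sin_diff by simp
qed

text \<open>Expanding the reflected sines shows that only the sine products with indices (m, n) and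
  (n, m) occur, and these lie in the same squares of indices.\<close>

lemma u_eq: "u m n (x, y) = sin (pi * real m * x) * sin (pi * real n * y)
   - (-1) ^ (m + n) * (sin (pi * real n * x) * sin (pi * real m * y))"
  unfolding u_def prod.case sin_reflect by (simp add: power_add mult_ac)

lemma u_refl: "u m n (refl_diag z) = - u m n z"
  by (cases z) (simp add: u_def refl_diag_def)

lemma continuous_on_u: "continuous_on A (u m n)"
  unfolding u_def case_prod_unfold by (intro continuous_intros)

definition pairs :: "nat \<Rightarrow> (nat \<times> nat) set" where
  "pairs N = {(m, n). 0 < m \<and> m < n \<and> n \<le> N}"

lemma finite_pairs: "finite (pairs N)"
  by (rule finite_subset[of _ "{..N} \<times> {..N}"]) (auto simp: pairs_def)

lemma pairs_mono: "N \<le> M \<Longrightarrow> pairs N \<subseteq> pairs M"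
  by (auto simp: pairs_def)

definition u_sum :: "(nat \<Rightarrow> nat \<Rightarrow> real) \<Rightarrow> nat \<Rightarrow> real \<times> real \<Rightarrow> real" where
  "u_sum c N x = (\<Sum>(m, n)\<in>pairs N. c m n * u m n x)"

lemma continuous_on_u_sum: "continuous_on A (u_sum c N)"
  unfolding u_sum_def case_prod_unfold by (intro continuous_intros continuous_on_u)

lemma u_sum_refl: "u_sum c N (refl_diag z) = - u_sum c N z"
  by (simp add: u_sum_def u_refl case_prod_unfold sum_negf)

lemma partial_sum_eq: "partial_sum N f = u_sum (fourier_coeff f) N"
  by (simp add: fun_eq_iff partial_sum_def u_sum_def pairs_def)

lemma sum_square_split:
  fixes g :: "nat \<Rightarrow> nat \<Rightarrow> real"
  assumes "\<And>m. g m m = 0"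
  shows "(\<Sum>m=1..N. \<Sum>n=1..N. g m n) = (\<Sum>(m, n)\<in>pairs N. g m n + g n m)"
proof -
  have "(\<Sum>m=1..N. \<Sum>n=1..N. g m n) = (\<Sum>(m, n)\<in>{1..N} \<times> {1..N}. g m n)"
    by (simp add: sum.cartesian_product)
  also have "\<dots> = (\<Sum>(m, n)\<in>pairs N \<union> prod.swap ` pairs N. g m n)"
    using assms by (intro sum.mono_neutral_right) (auto simp: pairs_def image_iff, metis linorder_neqE_nat)
  also have "\<dots> = (\<Sum>(m, n)\<in>pairs N. g m n) + (\<Sum>(m, n)\<in>prod.swap ` pairs N. g m n)"
    by (intro sum.union_disjoint finite_imageI finite_pairs) (auto simp: pairs_def)
  also have "(\<Sum>(m, n)\<in>prod.swap ` pairs N. g m n) = (\<Sum>(m, n)\<in>pairs N. g n m)"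
    by (subst sum.reindex) (auto simp: case_prod_unfold)
  finally show ?thesis by (simp add: case_prod_unfold sum.distrib)
qed

text \<open>The coefficient matrix does not depend on \<open>N\<close>. Truncating a sum of
  eigenfunctions at \<open>N\<close> is therefore square truncation of one double sine series; its
  diagonal is 0, as is \<open>u m m\<close>.\<close>

lemma u_sum_eq_sine_poly:
  "u_sum c N = sine_poly (\<lambda>m n. if m < n then c m n else if n < m then - ((-1) ^ (m + n)) * c n m else 0) N N"
proof
  fix z :: "real \<times> real"
  obtain x y where z: "z = (x, y)" by force
  show "u_sum c N z = sine_poly (\<lambda>m n. if m < n then c m n else if n < m then - ((-1) ^ (m + n)) * c n m else 0) N N z"
    unfolding z sine_poly_def prod.case
    by (subst sum_square_split)
       (auto simp: u_sum_def u_eq pairs_def algebra_simps intro!: sum.cong)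
qed

lemma u_sum_truncation_bound:
  assumes p: "1 < p"
  obtains C where "0 \<le> C" "\<And>M N c. N \<le> M \<Longrightarrow>
     (LINT x|tri. \<bar>u_sum c N x\<bar> powr p) \<le> C * (LINT x|tri. \<bar>u_sum c M x\<bar> powr p)"
proof -
  obtain C where C: "0 \<le> C" "\<And>M N a. N \<le> M \<Longrightarrow>
     integral unit_square (\<lambda>x. \<bar>sine_poly a N N x\<bar> powr p) \<le>
     C * integral unit_square (\<lambda>x. \<bar>sine_poly a M M x\<bar> powr p)"
    using sine_poly_truncation_bound[OF p] by blast
  have "(LINT x|tri. \<bar>u_sum c N x\<bar> powr p) \<le> C * (LINT x|tri. \<bar>u_sum c M x\<bar> powr p)"
    if "N \<le> M" for M N c
  proof -
    have cont: "continuous_on A (\<lambda>x. \<bar>u_sum c L x\<bar> powr p)" for A L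
      using continuous_on_norm_powr[OF continuous_on_u_sum[of A c L], of p] p by simp
    have sq: "integral unit_square (\<lambda>x. \<bar>u_sum c L x\<bar> powr p) = 2 * (LINT x|tri. \<bar>u_sum c L x\<bar> powr p)" for L
      unfolding tri_integral(1)[OF cont]
      by (intro integral_square_triangle tri_integral(2) cont) (simp add: u_sum_refl)
    from C(2)[OF that, of "\<lambda>m n. if m < n then c m n else if n < m then - ((-1) ^ (m + n)) * c n m else 0"]
    show ?thesis unfolding u_sum_eq_sine_poly[symmetric] sq by simp
  qed
  with C(1) that show ?thesis by blast
qed

text \<open>Of the four products of sines, the two that pair (m, n) with (l, k) integrate to 0
  because m < n and k < l. When the indices agree, the other two give 1 / 4 each over the square,
  and the triangle receives half of the total.\<close>

lemma u_orthogonal: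
  assumes "0 < m" "m < n" "0 < k" "k < l"
  shows "(LINT x|tri. u m n x * u k l x) = (if m = k \<and> n = l then 1 / 4 else 0)"
proof -
  define e where "e = (\<lambda>m n (z :: real \<times> real). sin (pi * real m * fst z) * sin (pi * real n * snd z))"
  have cont_e: "continuous_on A (e m n)" for A m n
    unfolding e_def by (intro continuous_intros)
  have ee: "integral unit_square (\<lambda>z. e m n z * e k l z) =
      (if m = k then 1 / 2 else 0) * (if n = l then 1 / 2 else 0)"
    if "0 < m" "0 < n" "0 < k" "0 < l" for m n k l
  proof -
    have "integral unit_square (\<lambda>z. e m n z * e k l z) = integral (cbox 0 1) (\<lambda>x. integral (cbox 0 1)
       (\<lambda>y. e m n (x, y) * e k l (x, y)))"
      by (intro integral_prod_continuous continuous_intros cont_e)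
    also have "\<dots> = integral {0..1} (\<lambda>x. integral {0..1} (\<lambda>y. (sin (pi * real m * x) * sin (pi * real k * x)) *
       (sin (pi * real n * y) * sin (pi * real l * y))))"
      by (simp add: e_def mult_ac)
    also have "\<dots> = integral {0..1} (\<lambda>x. (sin (pi * real m * x) * sin (pi * real k * x)) *
       integral {0..1} (\<lambda>y. sin (pi * real n * y) * sin (pi * real l * y)))"
      by (simp only: integral_mult_right)
    also have "\<dots> = integral {0..1} (\<lambda>x. sin (pi * real m * x) * sin (pi * real k * x)) *
       integral {0..1} (\<lambda>y. sin (pi * real n * y) * sin (pi * real l * y))"
      by (simp only: integral_mult_left)
    finally show ?thesis using that by (simp add: sin_orthogonal)
  qed
  have int: "(\<lambda>z. e m n z * e k l z) integrable_on unit_square" for m n k l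
    by (intro integrable_continuous continuous_intros cont_e)
  have cont: "continuous_on A (\<lambda>z. u m n z * u k l z)" for A
    by (intro continuous_intros continuous_on_u)
  have uu: "u m n z * u k l z = e m n z * e k l z - (-1) ^ (k + l) * (e m n z * e l k z)
      - (-1) ^ (m + n) * (e n m z * e k l z) + (-1) ^ (m + n) * (-1) ^ (k + l) * (e n m z * e l k z)" for z
    by (cases z) (simp add: u_eq e_def algebra_simps)
  have "2 * (LINT z|tri. u m n z * u k l z) = integral unit_square (\<lambda>z. u m n z * u k l z)"
    unfolding tri_integral(1)[OF cont]
    by (intro integral_square_triangle[symmetric] tri_integral(2) cont) (simp add: u_refl)
  also have "\<dots> = integral unit_square (\<lambda>z. e m n z * e k l z) - (-1) ^ (k + l) * integral unit_square (\<lambda>z. e m n z * e l k z)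
      - (-1) ^ (m + n) * integral unit_square (\<lambda>z. e n m z * e k l z)
      + (-1) ^ (m + n) * (-1) ^ (k + l) * integral unit_square (\<lambda>z. e n m z * e l k z)"
    unfolding uu using int
    by (simp add: integral_add integral_diff integrable_diff integrable_on_mult_right)
  also have "\<dots> = 2 * (if m = k \<and> n = l then 1 / 4 else 0)"
    using assms by (simp add: ee)
  finally show ?thesis by simp
qed

section \<open>Density of the eigenfunctions\<close>

text \<open>The p-th power of the norm; the root is taken only when convergence is
  concluded.\<close>

definition tri_int :: "real \<Rightarrow> (real \<times> real \<Rightarrow> real) \<Rightarrow> real" where
  "tri_int p f = (LINT x|tri. \<bar>f x\<bar> powr p)"

abbreviation "Lp_tri p \<equiv> Lp_space p right_triangle"

lemma tri_int_nonneg: "0 \<le> tri_int p f"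
  by (simp add: tri_int_def integral_nonneg_AE)

lemma Lp_tri_measurable: "f \<in> Lp_tri p \<Longrightarrow> f \<in> borel_measurable tri"
  by (simp add: Lp_space_def)

lemma Lp_tri_integrable: "f \<in> Lp_tri p \<Longrightarrow> integrable tri (\<lambda>x. \<bar>f x\<bar> powr p)"
  by (simp add: Lp_space_def)

lemma Lp_tri_continuous:
  assumes f: "continuous_on right_triangle f" and p: "0 < p"
  shows "f \<in> Lp_tri p"
  unfolding Lp_space_def
  using f continuous_on_norm_powr[OF f p] by (auto intro!: tri_measurable tri_integrable)

lemma Lp_tri_add:
  assumes f: "f \<in> Lp_tri p" and g: "g \<in> Lp_tri p" and p: "0 < p"
  shows "(\<lambda>x. f x + g x) \<in> Lp_tri p"
    and "tri_int p (\<lambda>x. f x + g x) \<le> 2 powr p * (tri_int p f + tri_int p g)"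
proof -
  note [measurable] = Lp_tri_measurable[OF f] Lp_tri_measurable[OF g]
  note int = Lp_tri_integrable[OF f] Lp_tri_integrable[OF g]
  have int': "integrable tri (\<lambda>x. 2 powr p * (\<bar>f x\<bar> powr p + \<bar>g x\<bar> powr p))"
    using int by auto
  have le: "\<bar>f x + g x\<bar> powr p \<le> 2 powr p * (\<bar>f x\<bar> powr p + \<bar>g x\<bar> powr p)" for x
    using norm_powr_add_le[OF p, of "f x" "g x"] by simp
  have int_sum: "integrable tri (\<lambda>x. \<bar>f x + g x\<bar> powr p)"
    by (rule Bochner_Integration.integrable_bound[OF int'])
       (use le in \<open>auto intro!: AE_I2 order.trans[OF le]\<close>)
  thus "(\<lambda>x. f x + g x) \<in> Lp_tri p" by (simp add: Lp_space_def)
  have "tri_int p (\<lambda>x. f x + g x) \<le> (LINT x|tri. 2 powr p * (\<bar>f x\<bar> powr p + \<bar>g x\<bar> powr p))"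
    unfolding tri_int_def by (intro integral_mono int_sum int' le)
  thus "tri_int p (\<lambda>x. f x + g x) \<le> 2 powr p * (tri_int p f + tri_int p g)"
    unfolding tri_int_def using int by simp
qed

lemma Lp_tri_minus: "f \<in> Lp_tri p \<Longrightarrow> (\<lambda>x. - f x) \<in> Lp_tri p"
  by (simp add: Lp_space_def)

lemma Lp_tri_diff:
  assumes "f \<in> Lp_tri p" "g \<in> Lp_tri p" "0 < p"
  shows "(\<lambda>x. f x - g x) \<in> Lp_tri p"
  using Lp_tri_add(1)[OF assms(1) Lp_tri_minus[OF assms(2)] assms(3)] by simp

lemma tri_int_triangle:
  assumes f: "f \<in> Lp_tri p" and g: "g \<in> Lp_tri p" and h: "h \<in> Lp_tri p" and p: "0 < p"
  shows "tri_int p (\<lambda>x. f x - h x) \<le> 2 powr p * (tri_int p (\<lambda>x. f x - g x) + tri_int p (\<lambda>x. g x - h x))"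
  using Lp_tri_add(2)[OF Lp_tri_diff[OF f g p] Lp_tri_diff[OF g h p] p] by simp

lemma measure_tri_le: "measure tri (space tri) \<le> 1"
proof -
  have "measure tri (space tri) = measure lebesgue right_triangle"
    by (simp add: measure_restrict_space right_triangle_sets)
  also have "\<dots> \<le> measure lebesgue unit_square"
    by (intro measure_mono_fmeasurable right_triangle_sets)
       (auto simp: right_triangle_eq mem_box Basis_prod_def inner_Pair)
  also have "\<dots> = 1" by (simp add: content_Pair measure_completion)
  finally show ?thesis .
qed

text \<open>The same splitting at \<open>\<delta>\<close> as on the circle, with the area of the
  triangle at most 1. It makes the integrals in the Fourier coefficients of an L^p function exist
  and bounds them.\<close>

lemma Lp_tri_L1:
  assumes f: "f \<in> Lp_tri p" and p: "1 \<le> p"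
  shows "integrable tri f" and "(LINT x|tri. \<bar>f x\<bar>) powr p \<le> 2 powr p * tri_int p f"
proof -
  note [measurable] = Lp_tri_measurable[OF f]
  note int = Lp_tri_integrable[OF f]
  interpret finite_measure tri by (rule finite_measure_tri)
  have le: "\<bar>f x\<bar> \<le> \<delta> + \<delta> powr (1 - p) * \<bar>f x\<bar> powr p" if "0 < \<delta>" for \<delta> x
    using that p by (intro le_add_powr) auto
  have int': "integrable tri (\<lambda>x. \<delta> + \<delta> powr (1 - p) * \<bar>f x\<bar> powr p)" for \<delta>
    using int by auto
  show f1: "integrable tri f"
    by (rule Bochner_Integration.integrable_bound[OF int'[of 1]])
       (use le[of 1] in \<open>auto intro!: AE_I2\<close>)
  show "(LINT x|tri. \<bar>f x\<bar>) powr p \<le> 2 powr p * tri_int p f"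
  proof (rule powr_le_of_le_add)
    fix \<delta> :: real assume d: "0 < \<delta>"
    have "(LINT x|tri. \<bar>f x\<bar>) \<le> (LINT x|tri. \<delta> + \<delta> powr (1 - p) * \<bar>f x\<bar> powr p)"
      using f1 d by (intro integral_mono int' le) auto
    also have "\<dots> = \<delta> * measure tri (space tri) + \<delta> powr (1 - p) * tri_int p f"
      unfolding tri_int_def using int by (simp add: mult.commute)
    also have "\<dots> \<le> \<delta> + \<delta> powr (1 - p) * tri_int p f"
      using d measure_tri_le by simp
    finally show "(LINT x|tri. \<bar>f x\<bar>) \<le> \<delta> + \<delta> powr (1 - p) * tri_int p f" .
  qed (use p tri_int_nonneg in auto)
qed

section \<open>Uniform approximation by sine polynomials\<close>

text \<open>Generated term by term, so that multiplication by cosines and antisymmetrisation are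
  inductions without coefficient arrays.\<close>

inductive sine_span :: "(real \<times> real \<Rightarrow> real) \<Rightarrow> bool" where
  zero: "sine_span (\<lambda>z. 0)"
| add_term: "sine_span h \<Longrightarrow> 0 < m \<Longrightarrow> 0 < n \<Longrightarrow>
    sine_span (\<lambda>z. h z + c * (sin (pi * real m * fst z) * sin (pi * real n * snd z)))"

lemma sine_span_term: "sine_span (\<lambda>z. c * (sin (pi * real m * fst z) * sin (pi * real n * snd z)))"
proof (cases "0 < m \<and> 0 < n")
  case True
  thus ?thesis using sine_span.add_term[OF sine_span.zero, of m n c] by simp
next
  case False
  hence "(\<lambda>z :: real \<times> real. c * (sin (pi * real m * fst z) * sin (pi * real n * snd z))) = (\<lambda>z. 0)" by auto
  thus ?thesis by (simp add: sine_span.zero)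
qed

lemma sine_span_add:
  assumes f: "sine_span f" and g: "sine_span g"
  shows "sine_span (\<lambda>z. f z + g z)"
  using g
proof induction
  case zero
  thus ?case using f by simp
next
  case (add_term h m n c)
  from sine_span.add_term[OF add_term.IH add_term.hyps(2,3), of c]
  show ?case by (simp add: add.assoc)
qed

lemma sine_span_scale: "sine_span g \<Longrightarrow> sine_span (\<lambda>z. d * g z)"
proof (induction rule: sine_span.induct)
  case zero
  show ?case using sine_span.zero by simp
next
  case (add_term h m n c)
  from sine_span_add[OF add_term.IH sine_span_term[of "d * c" m n]]
  show ?case by (simp add: algebra_simps)
qed

text \<open>The frequency \<open>m - 1\<close> may be 0; the corresponding term is then the zero
  function, which the span contains.\<close>

lemma cos_sin_raise:
  assumes "0 < m"
  shows "cos (pi * x) * sin (pi * real m * x) =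
    1 / 2 * sin (pi * real (m + 1) * x) + 1 / 2 * sin (pi * real (m - 1) * x)"
proof -
  have "pi * real (m + 1) * x = pi * real m * x + pi * x" "pi * real (m - 1) * x = pi * real m * x - pi * x"
    using assms by (simp_all add: of_nat_diff algebra_simps)
  thus ?thesis by (simp only: sin_add sin_diff) (simp add: field_simps)
qed

text \<open>Products of two sines are combinations of cosines, so \<open>sine_span\<close> is not an
  algebra and Stone-Weierstrass cannot be applied to it directly. Its multipliers do form an algebra
  with constants, and cos (pi x) and cos (pi y) among them separate the points of the
  square.\<close>

definition sine_multiplier :: "(real \<times> real \<Rightarrow> real) \<Rightarrow> bool" where
  "sine_multiplier h \<longleftrightarrow> (\<forall>v. sine_span v \<longrightarrow> sine_span (\<lambda>z. h z * v z))"

lemma sine_multiplier_cos: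
  "sine_multiplier (\<lambda>z. cos (pi * fst z))" "sine_multiplier (\<lambda>z. cos (pi * snd z))"
proof -
  have "sine_span (\<lambda>z. cos (pi * fst z) * v z) \<and> sine_span (\<lambda>z. cos (pi * snd z) * v z)" if "sine_span v" for v
    using that
  proof induction
    case zero
    show ?case using sine_span.zero by simp
  next
    case (add_term h m n c)
    have 1: "cos (pi * fst z) * (h z + c * (sin (pi * real m * fst z) * sin (pi * real n * snd z))) =
      cos (pi * fst z) * h z + (c / 2 * (sin (pi * real (m + 1) * fst z) * sin (pi * real n * snd z))
        + c / 2 * (sin (pi * real (m - 1) * fst z) * sin (pi * real n * snd z)))" for z
    proof -
      have "cos (pi * fst z) * (h z + c * (sin (pi * real m * fst z) * sin (pi * real n * snd z))) =
        cos (pi * fst z) * h z + c * (cos (pi * fst z) * sin (pi * real m * fst z)) * sin (pi * real n * snd z)"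
        by (simp add: algebra_simps)
      thus ?thesis unfolding cos_sin_raise[OF add_term.hyps(2)] by (simp add: algebra_simps)
    qed
    have 2: "cos (pi * snd z) * (h z + c * (sin (pi * real m * fst z) * sin (pi * real n * snd z))) =
      cos (pi * snd z) * h z + (c / 2 * (sin (pi * real m * fst z) * sin (pi * real (n + 1) * snd z))
        + c / 2 * (sin (pi * real m * fst z) * sin (pi * real (n - 1) * snd z)))" for z
    proof -
      have "cos (pi * snd z) * (h z + c * (sin (pi * real m * fst z) * sin (pi * real n * snd z))) =
        cos (pi * snd z) * h z + c * sin (pi * real m * fst z) * (cos (pi * snd z) * sin (pi * real n * snd z))"
        by (simp add: algebra_simps)
      thus ?thesis unfolding cos_sin_raise[OF add_term.hyps(3)] by (simp add: algebra_simps)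
    qed
    show ?case unfolding 1 2 using add_term.IH by (intro conjI sine_span_add sine_span_term) auto
  qed
  thus "sine_multiplier (\<lambda>z. cos (pi * fst z))" "sine_multiplier (\<lambda>z. cos (pi * snd z))"
    by (auto simp: sine_multiplier_def)
qed

abbreviation sin_weight :: "real \<times> real \<Rightarrow> real" where
  "sin_weight z \<equiv> sin (pi * fst z) * sin (pi * snd z)"

lemma sin_weight_bounds: "z \<in> unit_square \<Longrightarrow> 0 \<le> sin_weight z" "sin_weight z \<le> 1"
proof -
  show "0 \<le> sin_weight z" if "z \<in> unit_square"
    using that by (cases z) (auto simp: mem_box Basis_prod_def inner_Pair intro!: mult_nonneg_nonneg sin_ge_zero)
  have "\<bar>sin (pi * fst z)\<bar> * \<bar>sin (pi * snd z)\<bar> \<le> 1 * 1" by (intro mult_mono) auto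
  thus "sin_weight z \<le> 1" by (simp flip: abs_mult)
qed

text \<open>A multiplier \<open>g\<close> close to \<open>H\<close> is applied to
  \<open>sin_weight\<close>, itself a member of the span. Since the weight lies between 0 and 1 on
  the square, the error does not grow.\<close>

lemma sine_span_approx:
  assumes H: "continuous_on unit_square H" and e: "0 < e"
  obtains v where "sine_span v" "\<And>z. z \<in> unit_square \<Longrightarrow> \<bar>sin_weight z * H z - v z\<bar> \<le> e"
proof -
  have "\<exists>g. (continuous_on unit_square g \<and> sine_multiplier g) \<and> (\<forall>z\<in>unit_square. \<bar>H z - g z\<bar> < e)"
  proof (rule Stone_Weierstrass_HOL)
    show "\<exists>f. (continuous_on unit_square f \<and> sine_multiplier f) \<and> f x \<noteq> f y"
      if "x \<in> unit_square \<and> y \<in> unit_square \<and> x \<noteq> y" for x y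
    proof (cases "fst x = fst y")
      case True
      with that have "snd x \<noteq> snd y" by (auto simp: prod_eq_iff)
      moreover have "0 \<le> snd x" "snd x \<le> 1" "0 \<le> snd y" "snd y \<le> 1"
        using that by (cases x; cases y; auto simp: mem_box Basis_prod_def inner_Pair)+
      ultimately have "cos (pi * snd x) \<noteq> cos (pi * snd y)"
        using cos_inj_pi[of "pi * snd x" "pi * snd y"] by auto
      thus ?thesis
        by (intro exI[of _ "\<lambda>z. cos (pi * snd z)"]) (auto intro!: sine_multiplier_cos continuous_intros)
    next
      case False
      moreover have "0 \<le> fst x" "fst x \<le> 1" "0 \<le> fst y" "fst y \<le> 1"
        using that by (cases x; cases y; auto simp: mem_box Basis_prod_def inner_Pair)+
      ultimately have "cos (pi * fst x) \<noteq> cos (pi * fst y)"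
        using cos_inj_pi[of "pi * fst x" "pi * fst y"] by auto
      thus ?thesis
        by (intro exI[of _ "\<lambda>z. cos (pi * fst z)"]) (auto intro!: sine_multiplier_cos continuous_intros)
    qed
  next
    fix f g assume "(continuous_on unit_square f \<and> sine_multiplier f) \<and> (continuous_on unit_square g \<and> sine_multiplier g)"
    thus "continuous_on unit_square (\<lambda>x. f x + g x) \<and> sine_multiplier (\<lambda>x. f x + g x)"
      "continuous_on unit_square (\<lambda>x. f x * g x) \<and> sine_multiplier (\<lambda>x. f x * g x)"
      by (auto intro!: continuous_intros sine_span_add simp: sine_multiplier_def distrib_right mult.assoc)
  qed (use H e sine_span_scale in \<open>auto simp: sine_multiplier_def\<close>)
  then obtain g where g: "sine_multiplier g" "\<And>z. z \<in> unit_square \<Longrightarrow> \<bar>H z - g z\<bar> < e" by blast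
  have "sine_span (\<lambda>z. g z * sin_weight z)"
    using g(1) sine_span_term[of 1 1 1] by (simp add: sine_multiplier_def)
  moreover have "\<bar>sin_weight z * H z - g z * sin_weight z\<bar> \<le> e" if "z \<in> unit_square" for z
  proof -
    have "\<bar>sin_weight z * H z - g z * sin_weight z\<bar> = \<bar>sin_weight z\<bar> * \<bar>H z - g z\<bar>"
      by (simp add: algebra_simps flip: abs_mult)
    also have "\<dots> \<le> 1 * e"
      using sin_weight_bounds[of z] that g(2)[OF that] by (intro mult_mono) auto
    finally show ?thesis by simp
  qed
  ultimately show ?thesis using that by blast
qed

lemma u_sum_add_term:
  assumes "0 < m" "m < n"
  shows "\<exists>c' M'. \<forall>z. u_sum c M z + d * u m n z = u_sum c' M' z"
proof -
  \<comment> \<open>The values of \<open>c\<close> outside \<open>pairs M\<close> are arbitrary and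
    must be cut off before the range grows to \<open>M'\<close>.\<close>
  define c' where "c' = (\<lambda>i j. (if (i, j) \<in> pairs M then c i j else 0) + (if (i, j) = (m, n) then d else 0))"
  define M' where "M' = max M n"
  have "u_sum c' M' z = u_sum c M z + d * u m n z" for z
  proof -
    have "u_sum c' M' z = (\<Sum>ij\<in>pairs M'. (if ij \<in> pairs M then c (fst ij) (snd ij) * u (fst ij) (snd ij) z else 0)
       + (if ij = (m, n) then d * u (fst ij) (snd ij) z else 0))"
      unfolding u_sum_def c'_def by (intro sum.cong) (auto simp: distrib_right split: if_splits)
    also have "\<dots> = (\<Sum>ij\<in>pairs M'. (if ij \<in> pairs M then c (fst ij) (snd ij) * u (fst ij) (snd ij) z else 0))
       + (\<Sum>ij\<in>pairs M'. (if ij = (m, n) then d * u (fst ij) (snd ij) z else 0))"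
      by (rule sum.distrib)
    also have "(\<Sum>ij\<in>pairs M'. (if ij = (m, n) then d * u (fst ij) (snd ij) z else 0)) = d * u m n z"
      using assms by (subst sum.delta[OF finite_pairs]) (auto simp: pairs_def M'_def)
    also have "(\<Sum>ij\<in>pairs M'. (if ij \<in> pairs M then c (fst ij) (snd ij) * u (fst ij) (snd ij) z else 0)) =
       (\<Sum>ij\<in>pairs M. c (fst ij) (snd ij) * u (fst ij) (snd ij) z)"
      using pairs_mono[of M M']
      by (intro sum.mono_neutral_cong_right finite_pairs) (auto simp: M'_def)
    finally show ?thesis by (simp add: u_sum_def case_prod_unfold)
  qed
  thus ?thesis by metis
qed

text \<open>A sine product minus its reflection is \<open>u m n\<close> for the same indices. This
  is 0 for m = n, and equals \<open>u n m\<close> up to sign for n < m, so indices with m < n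
  suffice.\<close>

lemma sine_span_antisymmetrise:
  "sine_span v \<Longrightarrow> \<exists>c M. \<forall>z. v z - v (refl_diag z) = u_sum c M z"
proof (induction rule: sine_span.induct)
  case zero
  show ?case by (intro exI[of _ "\<lambda>_ _. 0"] exI[of _ 0]) (simp add: u_sum_def)
next
  case (add_term h m n d)
  then obtain c M where cM: "\<And>z. h z - h (refl_diag z) = u_sum c M z" by blast
  let ?v = "\<lambda>z. h z + d * (sin (pi * real m * fst z) * sin (pi * real n * snd z))"
  have "?v z - ?v (refl_diag z) = (h z - h (refl_diag z)) + d * u m n z" for z
    by (cases z) (simp add: refl_diag_def u_def algebra_simps)
  hence v: "?v z - ?v (refl_diag z) = u_sum c M z + d * u m n z" for z
    unfolding cM .
  consider "m < n" | "m = n" | "n < m" by linarith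
  thus ?case
  proof cases
    case 1
    thus ?thesis unfolding v using u_sum_add_term[of m n] add_term.hyps by blast
  next
    case 2
    have "u m n z = 0" for z using 2 by (cases z) (simp add: u_eq)
    thus ?thesis unfolding v by auto
  next
    case 3
    have "u m n z = - ((-1) ^ (m + n)) * u n m z" for z
      by (cases z) (simp add: u_eq algebra_simps flip: power_add mult_2)
    hence "d * u m n z = (d * - ((-1) ^ (m + n))) * u n m z" for z by simp
    thus ?thesis unfolding v using u_sum_add_term[of n m] 3 add_term.hyps by presburger
  qed
qed

lemma refl_diag_square: "z \<in> unit_square \<Longrightarrow> refl_diag z \<in> unit_square"
  using refl_diag_cbox[of 0 0 1 1] by auto

lemma triangle_subset_square: "z \<in> right_triangle \<Longrightarrow> z \<in> unit_square"
  by (auto simp: right_triangle_eq mem_box Basis_prod_def inner_Pair)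

lemma continuous_on_refl_diag: "continuous_on A refl_diag"
  unfolding refl_diag_def case_prod_unfold by (intro continuous_intros)

text \<open>The weight is invariant under the reflection, so the target is odd and antisymmetrising
  an approximant, with factor 1 / 2, averages two errors of size at most \<open>e\<close>.\<close>

lemma u_sum_uniform_approx:
  assumes H: "continuous_on unit_square H" and odd: "\<And>z. H (refl_diag z) = - H z" and e: "0 < e"
  obtains c M where "\<And>z. z \<in> unit_square \<Longrightarrow> \<bar>sin_weight z * H z - u_sum c M z\<bar> \<le> e"
proof -
  obtain v where v: "sine_span v" "\<And>z. z \<in> unit_square \<Longrightarrow> \<bar>sin_weight z * H z - v z\<bar> \<le> e"
    using sine_span_approx[OF H e] by blast
  obtain c M where cM: "\<And>z. 1 / 2 * v z - 1 / 2 * v (refl_diag z) = u_sum c M z"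
    using sine_span_antisymmetrise[OF sine_span_scale[OF v(1), of "1 / 2"]] by blast
  have "\<bar>sin_weight z * H z - u_sum c M z\<bar> \<le> e" if z: "z \<in> unit_square" for z
  proof -
    have "sin_weight (refl_diag z) = sin_weight z"
      using sin_reflect[of 1 "fst z"] sin_reflect[of 1 "snd z"] by (cases z) (simp add: refl_diag_def)
    hence "sin_weight (refl_diag z) * H (refl_diag z) = - (sin_weight z * H z)"
      unfolding odd by simp
    with v(2)[OF refl_diag_square[OF z]] v(2)[OF z] show ?thesis
      unfolding cM[symmetric] by linarith
  qed
  thus ?thesis using that by blast
qed

section \<open>Approximation in the mean\<close>

definition u_approximable :: "real \<Rightarrow> (real \<times> real \<Rightarrow> real) \<Rightarrow> bool" where
  "u_approximable p f \<longleftrightarrow> (\<forall>e>0. \<exists>c M. tri_int p (\<lambda>x. f x - u_sum c M x) < e)"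

lemma u_sum_Lp: "0 < p \<Longrightarrow> u_sum c M \<in> Lp_tri p"
  by (intro Lp_tri_continuous continuous_on_u_sum)

lemma u_approximable_limit:
  assumes p: "0 < p" and f: "f \<in> Lp_tri p" and g: "\<And>k :: nat. g k \<in> Lp_tri p" "\<And>k. u_approximable p (g k)"
    and lim: "(\<lambda>k. tri_int p (\<lambda>x. f x - g k x)) \<longlonglongrightarrow> 0"
  shows "u_approximable p f"
  unfolding u_approximable_def
proof safe
  fix e :: real assume e: "0 < e"
  define d where "d = e / (2 * 2 powr p)"
  have d: "0 < d" using e by (simp add: d_def)
  from order_tendstoD(2)[OF lim d] obtain k where k: "tri_int p (\<lambda>x. f x - g k x) < d"
    unfolding eventually_sequentially by blast
  obtain c M where cM: "tri_int p (\<lambda>x. g k x - u_sum c M x) < d"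
    using g(2)[of k] d unfolding u_approximable_def by blast
  have "tri_int p (\<lambda>x. f x - u_sum c M x) \<le> 2 powr p * (tri_int p (\<lambda>x. f x - g k x) + tri_int p (\<lambda>x. g k x - u_sum c M x))"
    by (intro tri_int_triangle f g u_sum_Lp p)
  also have "\<dots> < 2 powr p * (d + d)" using k cM by (intro mult_strict_left_mono add_strict_mono) auto
  also have "\<dots> = e" by (simp add: d_def)
  finally show "\<exists>c M. tri_int p (\<lambda>x. f x - u_sum c M x) < e" by blast
qed

lemma u_approximable_odd:
  assumes p: "0 < p" and H: "continuous_on unit_square H" and odd: "\<And>z. H (refl_diag z) = - H z"
    and f: "\<And>z. z \<in> right_triangle \<Longrightarrow> f z = sin_weight z * H z"
  shows "u_approximable p f"
  unfolding u_approximable_def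
proof safe
  fix e :: real assume e: "0 < e"
  define d where "d = (e / 2) powr (1 / p)"
  have d: "0 < d" "d powr p = e / 2" using e p by (auto simp: d_def powr_powr)
  obtain c M where cM: "\<And>z. z \<in> unit_square \<Longrightarrow> \<bar>sin_weight z * H z - u_sum c M z\<bar> \<le> d"
    using u_sum_uniform_approx[OF H odd d(1)] by blast
  interpret finite_measure tri by (rule finite_measure_tri)
  have "tri_int p (\<lambda>x. f x - u_sum c M x) \<le> (LINT x|tri. d powr p)"
    unfolding tri_int_def
  proof (rule integral_mono_AE')
    show "AE x in tri. \<bar>f x - u_sum c M x\<bar> powr p \<le> d powr p"
      using p cM f by (intro AE_I2 powr_mono2) (auto simp: triangle_subset_square)
  qed auto
  also have "\<dots> = e / 2 * measure tri (space tri)" using d by simp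
  also have "\<dots> \<le> e / 2 * 1" using e by (intro mult_left_mono measure_tri_le) auto
  finally show "\<exists>c M. tri_int p (\<lambda>x. f x - u_sum c M x) < e"
    using e by (intro exI[of _ c] exI[of _ M]) auto
qed

definition clamp_abs :: "real \<Rightarrow> real \<Rightarrow> real" where
  "clamp_abs B t = max (- B) (min B t)"

lemma clamp_abs_le: "0 \<le> B \<Longrightarrow> \<bar>clamp_abs B t\<bar> \<le> B"
  by (auto simp: clamp_abs_def)

text \<open>The three sides are null sets. Off them the sine weight is positive and x + y < 1, so
  pointwise convergence needs to be checked only there.\<close>

lemma AE_triangle_interior: "AE z in tri. 0 < fst z \<and> 0 < snd z \<and> fst z + snd z < 1"
proof -
  have neg: "negligible {x :: real \<times> real. (1, 0) \<bullet> x = 0}" "negligible {x :: real \<times> real. (0, 1) \<bullet> x = 0}"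
    "negligible {x :: real \<times> real. (1, 1) \<bullet> x = 1}"
    by (intro negligible_hyperplane; simp add: zero_prod_def)+
  have "AE z in lebesgue. z \<in> right_triangle \<longrightarrow> 0 < fst z \<and> 0 < snd z \<and> fst z + snd z < 1"
    unfolding eventually_ae_filter_negligible
    by (intro exI[of _ "{x. (1, 0) \<bullet> x = 0} \<union> {x. (0, 1) \<bullet> x = 0} \<union> {x. (1, 1) \<bullet> x = 1}"] conjI
          negligible_Un neg) (auto simp: right_triangle_eq inner_Pair)
  thus ?thesis by (subst AE_restrict_space_iff) (auto simp: right_triangle_sets)
qed

lemma continuous_on_clamp_abs: "continuous_on A f \<Longrightarrow> continuous_on A (\<lambda>z. clamp_abs B (f z))"
  unfolding clamp_abs_def by (intro continuous_intros)

lemma tri_int_dominated: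
  assumes p: "0 < p" and g: "\<And>k. g k \<in> borel_measurable tri" and w: "integrable tri w"
    and lim: "AE x in tri. (\<lambda>k. g k x) \<longlonglongrightarrow> 0" and dom: "\<And>k :: nat. AE x in tri. \<bar>g k x\<bar> powr p \<le> w x"
  shows "(\<lambda>k. tri_int p (g k)) \<longlonglongrightarrow> 0"
proof -
  note [measurable] = g
  have "(\<lambda>k. LINT x|tri. \<bar>g k x\<bar> powr p) \<longlonglongrightarrow> (LINT x|tri. 0)"
  proof (rule integral_dominated_convergence[OF _ _ w])
    show "AE x in tri. (\<lambda>k. \<bar>g k x\<bar> powr p) \<longlonglongrightarrow> 0"
      using lim
    proof eventually_elim
      case (elim x)
      have "(\<lambda>k. \<bar>g k x\<bar> powr p) \<longlonglongrightarrow> \<bar>0\<bar> powr p"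
        using p elim by (intro tendsto_powr2 tendsto_rabs tendsto_const) auto
      thus ?case by simp
    qed
  qed (use dom in auto)
  thus ?thesis by (simp add: tri_int_def)
qed

text \<open>The cutoff \<open>\<phi>\<close> vanishes on the hypotenuse, so that the odd reflection of the cut-off function is
  continuous; dividing by the regularised weight makes it a multiple of \<open>sin_weight\<close>.\<close>
lemma u_approximable_bounded:
  assumes p: "0 < p" and f: "f \<in> borel_measurable tri" and B: "0 \<le> B" "\<And>x. \<bar>f x\<bar> \<le> B"
  shows "u_approximable p f"
proof -
  interpret finite_measure tri by (rule finite_measure_tri)
  note [measurable] = f
  have "(\<lambda>x. if x \<in> right_triangle then f x else 0) \<in> borel_measurable lebesgue"
    using f by (intro borel_measurable_if_I right_triangle_sets)
  hence "(\<lambda>x. if x \<in> right_triangle then f x else 0) measurable_on right_triangle"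
    by (intro lebesgue_measurable_imp_measurable_on_real right_triangle_sets)
  \<comment> \<open>\<open>measurable_on\<close> supplies functions continuous on the whole plane
    that converge outside a negligible set.\<close>
  then obtain S g where S: "negligible S" and g: "\<And>n. continuous_on UNIV (g n)"
    "\<And>x. x \<notin> S \<Longrightarrow> (\<lambda>n. g n x) \<longlonglongrightarrow> (if x \<in> right_triangle then if x \<in> right_triangle then f x else 0 else 0)"
    unfolding measurable_on_def by blast
  have "(\<lambda>n. g n x) \<longlonglongrightarrow> f x" if "x \<notin> S" "x \<in> right_triangle" for x
    using g(2)[OF that(1)] that(2) by simp
  hence "AE x in lebesgue. x \<in> right_triangle \<longrightarrow> (\<lambda>n. g n x) \<longlonglongrightarrow> f x"
    unfolding eventually_ae_filter_negligible using S by blast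
  hence lim: "AE x in tri. (\<lambda>n. g n x) \<longlonglongrightarrow> f x"
    by (subst AE_restrict_space_iff) (auto simp: right_triangle_sets)
  define \<phi> where "\<phi> = (\<lambda>(k :: nat) (z :: real \<times> real). min 1 (max 0 (real k * (1 - fst z - snd z))))"
  define h where "h = (\<lambda>k z. clamp_abs B (g k z) * \<phi> k z / max (sin_weight z) (1 / real (Suc k)))"
  have cont_h: "continuous_on A (h k)" for k A
    unfolding h_def \<phi>_def using continuous_on_subset[OF g(1), of A k]
    by (intro continuous_intros continuous_on_clamp_abs) (auto simp: max_def)
  define r where "r = (\<lambda>k z. sin_weight z * h k z)"
  have cont_r: "continuous_on A (r k)" for k A
    unfolding r_def by (intro continuous_intros cont_h)
  show ?thesis
  proof (rule u_approximable_limit[OF p, where g = r])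
    show "f \<in> Lp_tri p"
      unfolding Lp_space_def using f B p
      by (auto intro!: integrable_const_bound[of _ "B powr p"] AE_I2 powr_mono2)
    show "r k \<in> Lp_tri p" for k by (intro Lp_tri_continuous p cont_r)
    show "u_approximable p (r k)" for k
    proof (rule u_approximable_odd[OF p, where H = "\<lambda>z. h k z - h k (refl_diag z)"])
      show "continuous_on unit_square (\<lambda>z. h k z - h k (refl_diag z))"
        by (intro continuous_intros cont_h continuous_on_compose2[OF cont_h[of UNIV] continuous_on_refl_diag]) auto
      \<comment> \<open>The cutoff is 0 at the reflection of any point of the triangle, so the odd
        combination agrees with \<open>h k\<close> on the triangle.\<close>
      show "r k z = sin_weight z * (h k z - h k (refl_diag z))" if "z \<in> right_triangle" for z
        using that by (auto simp: r_def h_def \<phi>_def right_triangle_eq refl_diag_def mult_nonneg_nonpos)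
    qed (simp add: refl_diag_idem)
    have r_bound: "\<bar>r k z\<bar> \<le> B" if "z \<in> right_triangle" for k z
    proof -
      have s: "0 \<le> sin_weight z" using that by (intro sin_weight_bounds triangle_subset_square)
      define q where "q = max (sin_weight z) (1 / real (Suc k))"
      have q: "0 < q" "sin_weight z \<le> q" by (auto simp: q_def less_max_iff_disj)
      have "\<bar>a * (b * c / q)\<bar> = \<bar>b\<bar> * (c * (a / q))" if "0 \<le> a" "0 \<le> c" for a b c
        using that q by (simp add: abs_mult)
      from this[OF s, of "\<phi> k z" "clamp_abs B (g k z)"]
      have "\<bar>r k z\<bar> = \<bar>clamp_abs B (g k z)\<bar> * (\<phi> k z * (sin_weight z / q))"
        unfolding r_def h_def q_def by (simp add: \<phi>_def)
      also have "\<dots> \<le> B * (1 * 1)"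
        using s q B by (intro mult_mono clamp_abs_le) (auto simp: \<phi>_def)
      finally show ?thesis by simp
    qed
    show "(\<lambda>k. tri_int p (\<lambda>x. f x - r k x)) \<longlonglongrightarrow> 0"
    proof (rule tri_int_dominated[OF p, where w = "\<lambda>x. (2 * B) powr p"])
      show "AE x in tri. (\<lambda>k. f x - r k x) \<longlonglongrightarrow> 0"
        using lim AE_triangle_interior
      proof eventually_elim
        case (elim x)
        define d where "d = 1 - fst x - snd x"
        have d: "0 < d" and s: "0 < sin_weight x"
          using elim by (auto simp: d_def intro!: mult_pos_pos sin_gt_zero)
        obtain k0 :: nat where k0: "1 / d < real k0" using reals_Archimedean2 by blast
        obtain k1 :: nat where k1: "1 / sin_weight x < real k1" using reals_Archimedean2 by blast
        \<comment> \<open>For such \<open>k\<close> neither the cutoff nor the regularised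
          denominator has an effect at \<open>x\<close>.\<close>
        have "r k x = clamp_abs B (g k x)" if "k \<ge> max k0 k1" for k
        proof -
          have "1 / d < real k" "1 / sin_weight x < real (Suc k)" using k0 k1 that by auto
          hence "1 \<le> real k * d" "1 / real (Suc k) \<le> sin_weight x"
            using d s by (auto simp: field_simps)
          hence "\<phi> k x = 1" "max (sin_weight x) (1 / real (Suc k)) = sin_weight x"
            by (auto simp: \<phi>_def d_def)
          moreover have "sin (pi * fst x) \<noteq> 0" "sin (pi * snd x) \<noteq> 0" using s by auto
          ultimately show ?thesis by (simp add: r_def h_def)
        qed
        hence ev: "eventually (\<lambda>k. clamp_abs B (g k x) = r k x) sequentially"
          unfolding eventually_sequentially by metis
        have "(\<lambda>k. clamp_abs B (g k x)) \<longlonglongrightarrow> clamp_abs B (f x)"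
          unfolding clamp_abs_def using elim(1) by (intro tendsto_intros)
        moreover have "clamp_abs B (f x) = f x" using B(2)[of x] by (auto simp: clamp_abs_def)
        ultimately have "(\<lambda>k. r k x) \<longlonglongrightarrow> f x" using Lim_transform_eventually[OF _ ev] by metis
        hence "(\<lambda>k. f x - r k x) \<longlonglongrightarrow> f x - f x" by (intro tendsto_intros)
        thus ?case by simp
      qed
      show "AE x in tri. \<bar>f x - r k x\<bar> powr p \<le> (2 * B) powr p" for k
      proof (rule AE_I2)
        fix x assume "x \<in> space tri"
        hence "\<bar>r k x\<bar> \<le> B" using r_bound by simp
        hence "\<bar>f x - r k x\<bar> \<le> 2 * B" using B(2)[of x] by linarith
        thus "\<bar>f x - r k x\<bar> powr p \<le> (2 * B) powr p" using p by (intro powr_mono2) auto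
      qed
      show "(\<lambda>x. f x - r k x) \<in> borel_measurable tri" for k
        by (intro borel_measurable_diff f tri_measurable cont_r)
    qed auto
  qed
qed

text \<open>Clamping at height \<open>k\<close> is eventually exact at each point, and
  \<open>\<bar>f x\<bar> powr p\<close> dominates the error.\<close>

lemma u_approximable_Lp:
  assumes p: "0 < p" and f: "f \<in> Lp_tri p"
  shows "u_approximable p f"
proof -
  note [measurable] = Lp_tri_measurable[OF f]
  interpret finite_measure tri by (rule finite_measure_tri)
  define g where "g = (\<lambda>(k :: nat) x. clamp_abs (real k) (f x))"
  have g_meas [measurable]: "g k \<in> borel_measurable tri" for k
    unfolding g_def clamp_abs_def by measurable
  have g_le: "\<bar>g k x\<bar> \<le> real k" for k x by (simp add: g_def clamp_abs_le)
  show ?thesis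
  proof (rule u_approximable_limit[OF p f, where g = g])
    show "g k \<in> Lp_tri p" for k
      unfolding Lp_space_def using p g_meas g_le
      by (auto intro!: integrable_const_bound[of _ "real k powr p"] AE_I2 powr_mono2)
    show "u_approximable p (g k)" for k
      by (rule u_approximable_bounded[OF p g_meas, of "real k"]) (use g_le in auto)
    show "(\<lambda>k. tri_int p (\<lambda>x. f x - g k x)) \<longlonglongrightarrow> 0"
    proof (rule tri_int_dominated[OF p _ Lp_tri_integrable[OF f]])
      show "AE x in tri. (\<lambda>k. f x - g k x) \<longlonglongrightarrow> 0"
      proof (rule AE_I2)
        fix x
        obtain k0 :: nat where k0: "\<bar>f x\<bar> < real k0" using reals_Archimedean2 by blast
        have "f x - g k x = 0" if "k \<ge> k0" for k
          using that k0 by (auto simp: g_def clamp_abs_def)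
        thus "(\<lambda>k. f x - g k x) \<longlonglongrightarrow> 0"
          by (intro tendsto_eventually) (auto simp: eventually_sequentially)
      qed
      show "AE x in tri. \<bar>f x - g k x\<bar> powr p \<le> \<bar>f x\<bar> powr p" for k
        using p by (intro AE_I2 powr_mono2) (auto simp: g_def clamp_abs_def)
    qed auto
  qed
qed

section \<open>Convergence of the partial sums\<close>

lemma u_norm:
  assumes "0 < m" "m < n"
  shows "(Lp_norm 2 right_triangle (u m n))\<^sup>2 = 1 / 4"
proof -
  have "(LINT x|tri. \<bar>u m n x\<bar> powr 2) = (LINT x|tri. u m n x * u m n x)"
    by (simp add: power2_eq_square powr_numeral flip: abs_mult)
  also have "\<dots> = 1 / 4" using u_orthogonal[OF assms assms] by simp
  finally show ?thesis unfolding Lp_norm_def by (simp add: powr_half_sqrt)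
qed

lemma fourier_coeff_eq:
  assumes "0 < m" "m < n"
  shows "fourier_coeff f m n = 4 * (LINT x|tri. f x * u m n x)"
  unfolding fourier_coeff_def u_norm[OF assms] by simp

lemma abs_u_le: "\<bar>u m n z\<bar> \<le> 2"
proof -
  have *: "\<bar>sin a * sin b\<bar> \<le> 1" for a b :: real
    using mult_mono[of "\<bar>sin a\<bar>" 1 "\<bar>sin b\<bar>" 1] by (simp add: abs_mult)
  have "\<bar>s - t\<bar> \<le> 2" if "\<bar>s\<bar> \<le> 1" "\<bar>t\<bar> \<le> 1" for s t :: real
    using that by linarith
  thus ?thesis unfolding u_def case_prod_unfold using * by blast
qed

lemma integrable_times_u:
  assumes f: "integrable tri f"
  shows "integrable tri (\<lambda>x. f x * u m n x)"
proof (rule Bochner_Integration.integrable_bound[of _ "\<lambda>x. 2 * \<bar>f x\<bar>"])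
  show "(\<lambda>x. f x * u m n x) \<in> borel_measurable tri"
    by (intro borel_measurable_times borel_measurable_integrable[OF f] tri_measurable continuous_on_u)
  show "AE x in tri. norm (f x * u m n x) \<le> norm (2 * \<bar>f x\<bar>)"
  proof (rule AE_I2)
    fix x
    have "\<bar>f x\<bar> * \<bar>u m n x\<bar> \<le> \<bar>f x\<bar> * 2" by (intro mult_left_mono abs_u_le) auto
    thus "norm (f x * u m n x) \<le> norm (2 * \<bar>f x\<bar>)" by (simp add: abs_mult mult.commute)
  qed
qed (use f in auto)

lemma fourier_coeff_add:
  assumes "integrable tri f" "integrable tri g"
  shows "fourier_coeff (\<lambda>x. f x + g x) m n = fourier_coeff f m n + fourier_coeff g m n"
  using integrable_times_u[OF assms(1), of m n] integrable_times_u[OF assms(2), of m n]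
  by (simp add: fourier_coeff_def distrib_right distrib_left)

lemma partial_sum_add:
  assumes "integrable tri f" "integrable tri g"
  shows "partial_sum N (\<lambda>x. f x + g x) z = partial_sum N f z + partial_sum N g z"
  by (simp add: partial_sum_eq u_sum_def fourier_coeff_add[OF assms] case_prod_unfold distrib_right sum.distrib)

lemma abs_fourier_coeff_le:
  assumes f: "integrable tri f" and mn: "0 < m" "m < n"
  shows "\<bar>fourier_coeff f m n\<bar> \<le> 8 * (LINT x|tri. \<bar>f x\<bar>)"
proof -
  have "\<bar>LINT x|tri. f x * u m n x\<bar> \<le> (LINT x|tri. \<bar>f x * u m n x\<bar>)"
    by (rule integral_abs_bound)
  also have "\<dots> \<le> (LINT x|tri. \<bar>f x\<bar> * 2)"
    using f integrable_abs[OF integrable_times_u[OF f, of m n]]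
    by (intro integral_mono) (auto simp: abs_mult intro!: mult_left_mono abs_u_le)
  finally show ?thesis unfolding fourier_coeff_eq[OF mn] by simp
qed

lemma fourier_coeff_u_sum:
  assumes mn: "0 < m" "m < n"
  shows "fourier_coeff (u_sum c M) m n = (if n \<le> M then c m n else 0)"
proof -
  have int: "integrable tri (\<lambda>x. c i j * (u i j x * u m n x))" for i j
    by (intro tri_integrable continuous_intros continuous_on_u)
  have "(LINT x|tri. u_sum c M x * u m n x) = (LINT x|tri. (\<Sum>ij\<in>pairs M. c (fst ij) (snd ij) * (u (fst ij) (snd ij) x * u m n x)))"
    by (simp add: u_sum_def case_prod_unfold sum_distrib_right mult.assoc)
  also have "\<dots> = (\<Sum>ij\<in>pairs M. LINT x|tri. c (fst ij) (snd ij) * (u (fst ij) (snd ij) x * u m n x))"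
    by (intro Bochner_Integration.integral_sum int)
  also have "\<dots> = (\<Sum>ij\<in>pairs M. if ij = (m, n) then c m n / 4 else 0)"
    using mn by (intro sum.cong) (auto simp: u_orthogonal pairs_def split: if_splits)
  also have "\<dots> = (if n \<le> M then c m n / 4 else 0)"
    using mn by (subst sum.delta[OF finite_pairs]) (auto simp: pairs_def)
  finally show ?thesis unfolding fourier_coeff_eq[OF mn] by auto
qed

text \<open>By orthogonality, taking a partial sum truncates for N < M and reproduces the sum from
  \<open>M\<close> on; \<open>min\<close> covers both cases.\<close>

lemma partial_sum_u_sum: "partial_sum N (u_sum c M) = u_sum c (min N M)"
proof
  fix z
  have "partial_sum N (u_sum c M) z = (\<Sum>ij\<in>pairs N. if ij \<in> pairs M then c (fst ij) (snd ij) * u (fst ij) (snd ij) z else 0)"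
    unfolding partial_sum_eq u_sum_def[of "fourier_coeff _"]
    by (intro sum.cong) (auto simp: pairs_def fourier_coeff_u_sum split: if_splits)
  also have "\<dots> = (\<Sum>ij\<in>pairs (min N M). c (fst ij) (snd ij) * u (fst ij) (snd ij) z)"
    by (intro sum.mono_neutral_cong_right finite_pairs) (auto simp: pairs_def)
  finally show "partial_sum N (u_sum c M) z = u_sum c (min N M) z"
    by (simp add: u_sum_def case_prod_unfold)
qed

section \<open>Uniform boundedness and convergence\<close>

lemma partial_sum_Lp: "0 < p \<Longrightarrow> partial_sum N f \<in> Lp_tri p"
  unfolding partial_sum_eq by (rule u_sum_Lp)

text \<open>Here \<open>K\<close> may depend on \<open>N\<close>. It expresses continuity of one
  fixed partial sum on L^p, by which estimates on the dense set of finite sums extend.\<close>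

lemma partial_sum_crude_bound:
  assumes p: "1 \<le> p"
  obtains K where "0 \<le> K" "\<And>f. f \<in> Lp_tri p \<Longrightarrow> tri_int p (partial_sum N f) \<le> K * tri_int p f"
proof -
  define k where "k = 16 * real (card (pairs N))"
  have "tri_int p (partial_sum N f) \<le> k powr p * 2 powr p * tri_int p f" if f: "f \<in> Lp_tri p" for f
  proof -
    let ?m = "LINT x|tri. \<bar>f x\<bar>"
    note f1 = Lp_tri_L1(1)[OF f p]
    have m0: "0 \<le> ?m" by (intro integral_nonneg_AE) auto
    have ptw: "\<bar>partial_sum N f z\<bar> \<le> k * ?m" for z
    proof -
      have "\<bar>partial_sum N f z\<bar> \<le> (\<Sum>ij\<in>pairs N. \<bar>fourier_coeff f (fst ij) (snd ij) * u (fst ij) (snd ij) z\<bar>)"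
        unfolding partial_sum_eq u_sum_def case_prod_unfold by (rule sum_abs)
      also have "\<dots> \<le> (\<Sum>ij\<in>pairs N. 8 * ?m * 2)"
        unfolding abs_mult using m0
        by (intro sum_mono mult_mono abs_fourier_coeff_le f1 abs_u_le) (auto simp: pairs_def)
      finally show ?thesis by (simp add: k_def mult_ac)
    qed
    interpret finite_measure tri by (rule finite_measure_tri)
    have km: "0 \<le> (k * ?m) powr p" by simp
    have "tri_int p (partial_sum N f) \<le> (LINT x|tri. (k * ?m) powr p)"
      unfolding tri_int_def
      by (rule integral_mono_AE') (use p ptw in \<open>auto intro!: AE_I2 powr_mono2\<close>)
    also have "\<dots> = (k * ?m) powr p * measure tri (space tri)" by simp
    also have "\<dots> \<le> (k * ?m) powr p * 1" using km by (intro mult_left_mono measure_tri_le)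
    also have "\<dots> = k powr p * ?m powr p" using m0 by (simp add: k_def powr_mult)
    also have "\<dots> \<le> k powr p * (2 powr p * tri_int p f)"
      by (intro mult_left_mono Lp_tri_L1(2) f p) auto
    finally show ?thesis by (simp add: mult.assoc)
  qed
  thus ?thesis using that[of "k powr p * 2 powr p"] by auto
qed

lemma partial_sum_uniform_bound:
  assumes p: "1 < p"
  obtains C where "0 \<le> C" "\<And>N f. f \<in> Lp_tri p \<Longrightarrow> tri_int p (partial_sum N f) \<le> C * tri_int p f"
proof -
  have p': "0 < p" "1 \<le> p" using p by auto
  obtain C where C: "0 \<le> C" "\<And>M N c. N \<le> M \<Longrightarrow> tri_int p (u_sum c N) \<le> C * tri_int p (u_sum c M)"
    using u_sum_truncation_bound[OF p] unfolding tri_int_def by blast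
  have "tri_int p (partial_sum N f) \<le> 2 powr p * (C * 2 powr p) * tri_int p f" if f: "f \<in> Lp_tri p" for N f
  proof (rule field_le_epsilon)
    fix e :: real assume e: "0 < e"
    obtain K where K: "0 \<le> K" "\<And>f. f \<in> Lp_tri p \<Longrightarrow> tri_int p (partial_sum N f) \<le> K * tri_int p f"
      using partial_sum_crude_bound[OF p'(2)] by blast
    define D where "D = 2 powr p * (C * 2 powr p + K)"
    have D: "0 \<le> D" using C(1) K(1) by (simp add: D_def)
    define d where "d = e / (D + 1)"
    have d: "0 < d" "D * d \<le> e" using D e by (auto simp: d_def field_simps)
    obtain c M where cM: "tri_int p (\<lambda>x. f x - u_sum c M x) < d"
      using u_approximable_Lp[OF p'(1) f] d(1) unfolding u_approximable_def by blast
    let ?h = "u_sum c M"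
    note h = u_sum_Lp[OF p'(1), of c M]
    note fh = Lp_tri_diff[OF f h p'(1)]
    have "tri_int p ?h \<le> 2 powr p * (tri_int p f + tri_int p (\<lambda>x. - (f x - ?h x)))"
      using Lp_tri_add(2)[OF f Lp_tri_minus[OF fh] p'(1)] by simp
    also have "tri_int p (\<lambda>x. - (f x - ?h x)) = tri_int p (\<lambda>x. f x - ?h x)"
      by (simp only: tri_int_def abs_minus_cancel)
    also have "2 powr p * (tri_int p f + tri_int p (\<lambda>x. f x - ?h x)) \<le> 2 powr p * (tri_int p f + d)"
      using cM by (intro mult_left_mono) auto
    finally have h_le: "tri_int p ?h \<le> 2 powr p * (tri_int p f + d)" .
    have "tri_int p (partial_sum N f) = tri_int p (\<lambda>x. partial_sum N ?h x + partial_sum N (\<lambda>x. f x - ?h x) x)"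
      using partial_sum_add[OF Lp_tri_L1(1)[OF h p'(2)] Lp_tri_L1(1)[OF fh p'(2)], of N]
      by (simp add: tri_int_def)
    also have "\<dots> \<le> 2 powr p * (tri_int p (partial_sum N ?h) + tri_int p (partial_sum N (\<lambda>x. f x - ?h x)))"
      by (intro Lp_tri_add(2) partial_sum_Lp p')
    also have "\<dots> \<le> 2 powr p * (C * (2 powr p * (tri_int p f + d)) + K * d)"
    proof (intro mult_left_mono add_mono)
      have "tri_int p (partial_sum N ?h) \<le> C * tri_int p ?h"
        unfolding partial_sum_u_sum by (rule C(2)) simp
      also have "\<dots> \<le> C * (2 powr p * (tri_int p f + d))"
        by (intro mult_left_mono h_le C)
      finally show "tri_int p (partial_sum N ?h) \<le> C * (2 powr p * (tri_int p f + d))" .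
      have "tri_int p (partial_sum N (\<lambda>x. f x - ?h x)) \<le> K * tri_int p (\<lambda>x. f x - ?h x)"
        by (rule K(2)[OF fh])
      also have "\<dots> \<le> K * d" using cM K by (intro mult_left_mono) auto
      finally show "tri_int p (partial_sum N (\<lambda>x. f x - ?h x)) \<le> K * d" .
    qed auto
    also have "\<dots> = 2 powr p * (C * 2 powr p) * tri_int p f + D * d"
      by (simp add: D_def algebra_simps)
    finally show "tri_int p (partial_sum N f) \<le> 2 powr p * (C * 2 powr p) * tri_int p f + e"
      using d(2) by linarith
  qed
  thus ?thesis using that[of "2 powr p * (C * 2 powr p)"] C(1) by simp
qed

theorem theorem4:
  fixes p :: real and f :: "real \<times> real \<Rightarrow> real"
  assumes "1 < p" and "f \<in> Lp_space p right_triangle"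
  shows "Lp_converges p right_triangle (\<lambda>N. partial_sum N f) f"
proof -
  note p = assms(1) and f = assms(2)
  have p': "0 < p" "1 \<le> p" using p by auto
  obtain C where C: "0 \<le> C" "\<And>N f. f \<in> Lp_tri p \<Longrightarrow> tri_int p (partial_sum N f) \<le> C * tri_int p f"
    using partial_sum_uniform_bound[OF p] by blast
  have lim: "(\<lambda>N. tri_int p (\<lambda>x. partial_sum N f x - f x)) \<longlonglongrightarrow> 0"
  proof (rule order_tendstoI)
    fix e :: real assume e: "0 < e"
    define d where "d = e / (2 powr p * (C + 1))"
    have pos: "0 < 2 powr p * (C + 1)" using C(1) by simp
    have "0 < d" using e pos unfolding d_def by (rule divide_pos_pos)
    moreover have "d * (2 powr p * (C + 1)) = e" using C(1) unfolding d_def by simp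
    ultimately have d: "0 < d" "2 powr p * (C * d + d) = e" by (simp_all add: algebra_simps)
    obtain c M where cM: "tri_int p (\<lambda>x. f x - u_sum c M x) < d"
      using u_approximable_Lp[OF p'(1) f] d(1) unfolding u_approximable_def by blast
    let ?h = "u_sum c M"
    note h = u_sum_Lp[OF p'(1), of c M]
    note fh = Lp_tri_diff[OF f h p'(1)]
    have "tri_int p (\<lambda>x. partial_sum N f x - f x) < e" if N: "N \<ge> M" for N
    proof -
      have "partial_sum N f x = ?h x + partial_sum N (\<lambda>x. f x - ?h x) x" for x
        using partial_sum_add[OF Lp_tri_L1(1)[OF h p'(2)] Lp_tri_L1(1)[OF fh p'(2)], of N x] N
        by (simp add: partial_sum_u_sum)
      hence "tri_int p (\<lambda>x. partial_sum N f x - f x) =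
         tri_int p (\<lambda>x. partial_sum N (\<lambda>x. f x - ?h x) x + - (f x - ?h x))"
        by (simp add: algebra_simps)
      also have "\<dots> \<le> 2 powr p * (tri_int p (partial_sum N (\<lambda>x. f x - ?h x)) + tri_int p (\<lambda>x. - (f x - ?h x)))"
        by (intro Lp_tri_add(2) partial_sum_Lp p' Lp_tri_minus fh)
      also have "tri_int p (\<lambda>x. - (f x - ?h x)) = tri_int p (\<lambda>x. f x - ?h x)"
        by (simp only: tri_int_def abs_minus_cancel)
      also have "2 powr p * (tri_int p (partial_sum N (\<lambda>x. f x - ?h x)) + tri_int p (\<lambda>x. f x - ?h x))
          < 2 powr p * (C * d + d)"
        using C(2)[OF fh, of N] mult_left_mono[OF less_imp_le[OF cM] C(1)] cM
        by (intro mult_strict_left_mono add_le_less_mono) auto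
      finally show ?thesis using d(2) by simp
    qed
    thus "eventually (\<lambda>N. tri_int p (\<lambda>x. partial_sum N f x - f x) < e) sequentially"
      unfolding eventually_sequentially by blast
  next
    fix e :: real assume "e < 0"
    thus "eventually (\<lambda>N. e < tri_int p (\<lambda>x. partial_sum N f x - f x)) sequentially"
      by (intro always_eventually allI) (auto intro: less_le_trans tri_int_nonneg)
  qed
  have "(\<lambda>N. tri_int p (\<lambda>x. partial_sum N f x - f x) powr (1 / p)) \<longlonglongrightarrow> 0 powr (1 / p)"
    using p' by (intro tendsto_powr2 lim tendsto_const) (auto simp: tri_int_nonneg)
  thus ?thesis
    using f p'(1) by (simp add: Lp_converges_def Lp_norm_def tri_int_def partial_sum_Lp)
qed

end
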